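(* Let $S\subset\,]0,+\infty[$ be countable. The universal minimal flow of $\mathrm{iso}(\mathbf{B}_S)$ is the set $\mathrm{cLO}(\mathbf{B}_S)$ of convex linear orderings on $\mathbf{B}_S$ together with the action $\mathrm{iso}(\mathbf{B}_S)\times\mathrm{cLO}(\mathbf{B}_S)\longrightarrow\mathrm{cLO}(\mathbf{B}_S)$, $(g,<)\longmapsto\, <^g$, defined by $$x<^g y\quad\text{iff}\quad g^{-1}(x)<g^{-1}(y).$$
   Context: For $S\subset\,]0,+\infty[$ at most countable, $\mathbf{B}_S$ is the ultrametric space of all finitely supported elements of $\mathbb{Q}^S$ with distance $d(x,y)=\max\{s\in S: x(s)\neq y(s)\}$ for $x\neq y$ (it is the countable ultrahomogeneous metric space whose finite subspaces are, up to isometry, exactly the finite ultrametric spaces with distances in $S$). $\mathrm{iso}(\mathbf{B}_S)$ is the group of isometries of $\mathbf{B}_S$ onto itself, equipped with the topology of pointwise convergence relative to the discrete topology on $\mathbf{B}_S$. A linear ordering on $\mathbf{B}_S$ is convex when all metric balls of $\mathbf{B}_S$ are convex for it. $\mathrm{cLO}(\mathbf{B}_S)$ carries the compact topology whose basic open sets are $\{\prec\,\in\mathrm{cLO}(\mathbf{B}_S): \prec\restriction F=\,<\restriction F\}$, for $F\subset\mathbf{B}_S$ finite and $<\,\in\mathrm{cLO}(\mathbf{B}_S)$. For a topological group $G$, a $G$-flow is a continuous action of $G$ on a (nonempty) compact Hausdorff space; it is minimal when every orbit is dense. A homomorphism of $G$-flows is a continuous $G$-equivariant map. The universal minimal flow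 of $G$ is the minimal $G$-flow, unique up to isomorphism, which admits a surjective homomorphism onto every minimal $G$-flow. *)

theory Defs
  imports "HOL-Analysis.Analysis" "HOL-Algebra.Group_Action"
begin

section \<open>Topological groups and their flows\<close>

definition topological_group :: "('g, 'm) monoid_scheme \<Rightarrow> 'g topology \<Rightarrow> bool" where
  "topological_group G T \<longleftrightarrow>
     group G \<and> topspace T = carrier G \<and>
     continuous_map (prod_topology T T) T (\<lambda>(g, h). g \<otimes>\<^bsub>G\<^esub> h) \<and>
     continuous_map T T (\<lambda>g. inv\<^bsub>G\<^esub> g)"

definition flow ::
  "('g, 'm) monoid_scheme \<Rightarrow> 'g topology \<Rightarrow> 'x topology \<Rightarrow> ('g \<Rightarrow> 'x \<Rightarrow> 'x) \<Rightarrow> bool" where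
  "flow G T X \<phi> \<longleftrightarrow>
     topological_group G T \<and>
     topspace X \<noteq> {} \<and> compact_space X \<and> Hausdorff_space X \<and>
     group_action G (topspace X) \<phi> \<and>
     continuous_map (prod_topology T X) X (\<lambda>(g, x). \<phi> g x)"

definition minimal_flow ::
  "('g, 'm) monoid_scheme \<Rightarrow> 'g topology \<Rightarrow> 'x topology \<Rightarrow> ('g \<Rightarrow> 'x \<Rightarrow> 'x) \<Rightarrow> bool" where
  "minimal_flow G T X \<phi> \<longleftrightarrow>
     flow G T X \<phi> \<and> (\<forall>x \<in> topspace X. X closure_of (orbit G \<phi> x) = topspace X)"

definition flow_hom ::
  "('g, 'm) monoid_scheme \<Rightarrow> 'x topology \<Rightarrow> ('g \<Rightarrow> 'x \<Rightarrow> 'x)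
     \<Rightarrow> 'y topology \<Rightarrow> ('g \<Rightarrow> 'y \<Rightarrow> 'y) \<Rightarrow> ('x \<Rightarrow> 'y) \<Rightarrow> bool" where
  "flow_hom G X \<phi> Y \<psi> \<pi> \<longleftrightarrow>
     continuous_map X Y \<pi> \<and>
     (\<forall>g \<in> carrier G. \<forall>x \<in> topspace X. \<pi> (\<phi> g x) = \<psi> g (\<pi> x))"

definition flow_isomorphic ::
  "('g, 'm) monoid_scheme \<Rightarrow> 'x topology \<Rightarrow> ('g \<Rightarrow> 'x \<Rightarrow> 'x)
     \<Rightarrow> 'y topology \<Rightarrow> ('g \<Rightarrow> 'y \<Rightarrow> 'y) \<Rightarrow> bool" where
  "flow_isomorphic G X \<phi> Y \<psi> \<longleftrightarrow>
     (\<exists>\<pi>. flow_hom G X \<phi> Y \<psi> \<pi> \<and> homeomorphic_map X Y \<pi>)"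

text \<open>
  A formula cannot quantify over all types, so the type carrying the minimal flows \<open>Y\<close> that
  \<open>X\<close> is tested against is a parameter.  In a theorem where \<open>'y\<close> is a type variable, \<open>Y\<close>
  ranges over the minimal flows on arbitrary types; in a hypothesis a concrete type has to be
  chosen, and the hypothesis then is weaker than universality among all minimal flows.
\<close>

definition universal_minimal_flow ::
  "'y itself \<Rightarrow> ('g, 'm) monoid_scheme \<Rightarrow> 'g topology \<Rightarrow> 'x topology \<Rightarrow> ('g \<Rightarrow> 'x \<Rightarrow> 'x) \<Rightarrow> bool" where
  "universal_minimal_flow (_ :: 'y itself) G T X \<phi> \<longleftrightarrow>
     minimal_flow G T X \<phi> \<and>
     (\<forall>(Y :: 'y topology) \<psi>. minimal_flow G T Y \<psi> \<longrightarrow>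
        (\<exists>\<pi>. flow_hom G X \<phi> Y \<psi> \<pi> \<and> \<pi> ` topspace X = topspace Y))"


section \<open>The ultrametric space of finitely supported elements of \<open>\<rat>\<^sup>S\<close>\<close>

type_synonym point = "real \<Rightarrow> rat"

definition B_pts :: "real set \<Rightarrow> point set" where
  "B_pts S = {x \<in> S \<rightarrow>\<^sub>E UNIV. finite {s \<in> S. x s \<noteq> 0}}"

text \<open>
  The locale \<open>Metric_space\<close> requires a distance to be symmetric and nonnegative on the whole
  type, whence the value \<open>0\<close> outside the space.
\<close>

definition B_dist :: "real set \<Rightarrow> point \<Rightarrow> point \<Rightarrow> real" where
  "B_dist S x y =
     (if x \<in> B_pts S \<and> y \<in> B_pts S \<and> x \<noteq> y then Max {s \<in> S. x s \<noteq> y s} else 0)"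

lemma finite_B_diff:
  assumes "x \<in> B_pts S" "y \<in> B_pts S"
  shows "finite {s \<in> S. x s \<noteq> y s}"
proof (rule finite_subset)
  show "{s \<in> S. x s \<noteq> y s} \<subseteq> {s \<in> S. x s \<noteq> 0} \<union> {s \<in> S. y s \<noteq> 0}" by auto
qed (use assms in \<open>simp add: B_pts_def\<close>)

lemma B_diff_nonempty:
  assumes "x \<in> B_pts S" "y \<in> B_pts S" "x \<noteq> y"
  shows "{s \<in> S. x s \<noteq> y s} \<noteq> {}"
  using assms PiE_ext[of x S "\<lambda>_. UNIV" y] by (auto simp: B_pts_def)

lemma B_dist_in:
  assumes "x \<in> B_pts S" "y \<in> B_pts S" "x \<noteq> y"
  shows "B_dist S x y \<in> S" "x (B_dist S x y) \<noteq> y (B_dist S x y)"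
  using Max_in[OF finite_B_diff[OF assms(1,2)] B_diff_nonempty[OF assms]] assms
  by (auto simp: B_dist_def)

lemma B_dist_ge:
  assumes "x \<in> B_pts S" "y \<in> B_pts S" "s \<in> S" "x s \<noteq> y s"
  shows "s \<le> B_dist S x y"
  using assms finite_B_diff[OF assms(1,2)] by (auto simp: B_dist_def intro!: Max_ge)

lemma B_dist_pos:
  assumes "S \<subseteq> {0<..}" "x \<in> B_pts S" "y \<in> B_pts S" "x \<noteq> y"
  shows "0 < B_dist S x y"
  using assms(1) B_dist_in(1)[OF assms(2-4)] by auto

lemma B_dist_nonneg:
  assumes "S \<subseteq> {0<..}"
  shows "0 \<le> B_dist S x y"
proof (cases "x \<in> B_pts S \<and> y \<in> B_pts S \<and> x \<noteq> y")
  case True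
  then show ?thesis using B_dist_pos[OF assms, of x y] by simp
next
  case False
  then have "B_dist S x y = 0" unfolding B_dist_def by (rule if_not_P)
  then show ?thesis by simp
qed

lemma B_dist_commute: "B_dist S x y = B_dist S y x"
proof -
  have "{s \<in> S. x s \<noteq> y s} = {s \<in> S. y s \<noteq> x s}" by auto
  then show ?thesis by (simp add: B_dist_def conj_ac)
qed

lemma B_dist_ultrametric:
  assumes "S \<subseteq> {0<..}" "x \<in> B_pts S" "y \<in> B_pts S" "z \<in> B_pts S"
  shows "B_dist S x z \<le> max (B_dist S x y) (B_dist S y z)"
proof (cases "x = z")
  case True
  then show ?thesis using B_dist_nonneg[OF assms(1), of x y] by (simp add: B_dist_def)
next
  case False
  note D = B_dist_in[OF assms(2,4) False]
  then have "x (B_dist S x z) \<noteq> y (B_dist S x z) \<or> y (B_dist S x z) \<noteq> z (B_dist S x z)"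
    by auto
  then show ?thesis using B_dist_ge[OF assms(2,3) D(1)] B_dist_ge[OF assms(3,4) D(1)] by auto
qed

lemma Metric_space_B:
  assumes "S \<subseteq> {0<..}"
  shows "Metric_space (B_pts S) (B_dist S)"
proof
  fix x y z
  assume "x \<in> B_pts S" "y \<in> B_pts S"
  then show "B_dist S x y = 0 \<longleftrightarrow> x = y"
    using B_dist_pos[OF assms, of x y] by (auto simp: B_dist_def)
  assume "z \<in> B_pts S"
  then show "B_dist S x z \<le> B_dist S x y + B_dist S y z"
    using B_dist_ultrametric[OF assms, of x y z] \<open>x \<in> B_pts S\<close> \<open>y \<in> B_pts S\<close>
      B_dist_nonneg[OF assms, of x y] B_dist_nonneg[OF assms, of y z] by linarith
qed (simp_all add: B_dist_nonneg[OF assms] B_dist_commute)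


section \<open>The isometry group\<close>

definition iso_group :: "real set \<Rightarrow> (point \<Rightarrow> point) monoid" where
  "iso_group S = (BijGroup (B_pts S))
     \<lparr>carrier := {g \<in> Bij (B_pts S).
        \<forall>x \<in> B_pts S. \<forall>y \<in> B_pts S. B_dist S (g x) (g y) = B_dist S x y}\<rparr>"

definition iso_topology :: "real set \<Rightarrow> (point \<Rightarrow> point) topology" where
  "iso_topology S =
     subtopology (product_topology (\<lambda>_. discrete_topology (B_pts S)) (B_pts S))
       (carrier (iso_group S))"


section \<open>Convex linear orderings\<close>

text \<open>
  A linear ordering is represented by the set of pairs \<open>(x, y)\<close> with \<open>x\<close> strictly below \<open>y\<close>.
  As \<open>strict_linear_order_on\<close> does not confine the relation to the given set, this is
  required separately.
\<close>

definition order_convex :: "'a set \<Rightarrow> 'a rel \<Rightarrow> 'a set \<Rightarrow> bool" where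
  "order_convex A r C \<longleftrightarrow>
     (\<forall>x \<in> C. \<forall>y \<in> C. \<forall>z \<in> A. (x, z) \<in> r \<and> (z, y) \<in> r \<longrightarrow> z \<in> C)"

definition cLO :: "real set \<Rightarrow> point rel set" where
  "cLO S = {r. r \<subseteq> B_pts S \<times> B_pts S \<and> strict_linear_order_on (B_pts S) r \<and>
     (\<forall>x \<in> B_pts S. \<forall>t.
        order_convex (B_pts S) r (Metric_space.mball (B_pts S) (B_dist S) x t) \<and>
        order_convex (B_pts S) r (Metric_space.mcball (B_pts S) (B_dist S) x t))}"

definition cLO_basic :: "real set \<Rightarrow> point set \<Rightarrow> point rel \<Rightarrow> point rel set" where
  "cLO_basic S F r = {q \<in> cLO S. Restr q F = Restr r F}"

definition cLO_topology :: "real set \<Rightarrow> point rel topology" where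
  "cLO_topology S =
     topology_generated_by {cLO_basic S F r | F r. finite F \<and> F \<subseteq> B_pts S \<and> r \<in> cLO S}"

lemma topspace_cLO_topology [simp]: "topspace (cLO_topology S) = cLO S"
  unfolding cLO_topology_def topology_generated_by_topspace
  by (fastforce simp: cLO_basic_def)

text \<open>
  The library's group actions take values in extensional bijections, so each \<open>cLO_action S g\<close>
  is restricted to \<open>cLO S\<close>.
\<close>

definition cLO_action :: "real set \<Rightarrow> (point \<Rightarrow> point) \<Rightarrow> point rel \<Rightarrow> point rel" where
  "cLO_action S g = (\<lambda>r \<in> cLO S.
     {(x, y) \<in> B_pts S \<times> B_pts S.
        ((inv\<^bsub>iso_group S\<^esub> g) x, (inv\<^bsub>iso_group S\<^esub> g) y) \<in> r})"

end

theory Submission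
  imports Defs "HOL-Library.Ramsey" "HOL-Algebra.Generated_Groups" "HOL-Combinatorics.Transposition"
begin

text \<open>
  Write \<open>B\<close> for the space, \<open>d\<close> for its distance, \<open>G\<close> for its isometry group and \<open>lexo\<close> for the
  lexicographic ordering of \<open>B\<close>, in which the largest coordinate where two points differ decides.
  The heart of the matter is that the isometries preserving \<open>lexo\<close> have a fixed point \<open>y\<close> in every
  \<open>G\<close>-flow \<open>Y\<close>.  Since the orbit of \<open>lexo\<close> is dense in the space of convex orderings,
  \<open>g lexo \<mapsto> g y\<close> then extends to a homomorphism from the convex orderings to \<open>Y\<close>.

  The fixed point is found one coordinate at a time.  For \<open>t \<in> S\<close>, a centre \<open>c\<close> and an increasing
  bijection \<open>f\<close> of the rationals, the move \<open>mv t c f\<close> applies \<open>f\<close> to the coordinate \<open>t\<close> of the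
  points of the closed ball of radius \<open>t\<close> about \<open>c\<close>.  For fixed \<open>t\<close> and \<open>c\<close> the moves form a copy of
  the group of increasing bijections of the rationals, which is extremely amenable by Ramsey's
  theorem (\<open>rat_auts_extremely_amenable\<close>).  Moves at the same level about different balls commute,
  and conjugation by a move at a higher level permutes the moves of a lower level (\<open>move_conj\<close>).
  Hence the set of points fixed by all moves below some level is invariant under the moves of that
  level, so fixed points can be accumulated upwards through any finite set of levels, and
  compactness yields a common fixed point of all moves (\<open>moves_fixed_point\<close>).
  The group generated by the moves is dense in the group of isometries preserving \<open>lexo\<close>
  (\<open>move_group_dense_in_lex_automorphisms\<close>).  This makes the closure of
  \<open>{(g lexo, g y) | g \<in> G}\<close> the graph of a function (\<open>graph_closure_single_valued\<close>), and this
  function is the homomorphism.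

  The same tools settle minimality and uniqueness.  A convex ordering fixed by all moves arises from
  \<open>lexo\<close> by reversing it between the points whose distance lies in some set \<open>E\<close>
  (\<open>move_group_fixed_is_flip\<close>).  Such a flip commutes with the action and is an involution.
  So every orbit closure contains a flip of \<open>lexo\<close>, whose orbit is dense because that of \<open>lexo\<close> is; and
  every endomorphism of the flow of convex orderings is a flip (\<open>cLO_endomorphism_is_flip\<close>).
  If \<open>Z\<close> also has the universal property, then the homomorphisms to \<open>Z\<close> and back compose to a flip,
  so the first one is injective, hence an isomorphism.
\<close>

section \<open>Increasing bijections of the rationals\<close>

definition rat_auts :: "(rat \<Rightarrow> rat) set" where
  "rat_auts = {f. strict_mono f \<and> bij f}"

lemma rat_auts_id: "id \<in> rat_auts"
  by (auto simp: rat_auts_def strict_mono_def)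

lemma rat_auts_comp: "f \<in> rat_auts \<Longrightarrow> g \<in> rat_auts \<Longrightarrow> f \<circ> g \<in> rat_auts"
  by (auto simp: rat_auts_def strict_mono_def bij_comp)

lemma rat_auts_inv:
  assumes "f \<in> rat_auts"
  shows "inv_into UNIV f \<in> rat_auts" "inv_into UNIV f \<circ> f = id" "f \<circ> inv_into UNIV f = id" "bij f"
proof -
  show b: "bij f" using assms by (simp add: rat_auts_def)
  show "inv_into UNIV f \<circ> f = id" by (rule inv_o_cancel[OF bij_is_inj[OF b]])
  show s: "f \<circ> inv_into UNIV f = id" using b by (auto simp: bij_is_surj surj_f_inv_f)
  have "inv_into UNIV f x < inv_into UNIV f y" if "x < y" for x y
    using assms that strict_mono_less[of f "inv_into UNIV f x" "inv_into UNIV f y"] s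
    by (simp add: rat_auts_def fun_eq_iff)
  then show "inv_into UNIV f \<in> rat_auts"
    using b by (auto simp: rat_auts_def strict_mono_def bij_imp_bij_inv)
qed

text \<open>
  Induction on the largest point \<open>b\<close> of the domain: above the second largest point \<open>a\<close>, an extension
  for the smaller points is replaced by the affine map that sends \<open>a\<close> and \<open>b\<close> to the right places.
\<close>

lemma strict_mono_on_rat_extends:
  fixes p :: "rat \<Rightarrow> rat"
  assumes "finite P" "strict_mono_on P p"
  shows "\<exists>f \<in> rat_auts. \<forall>x \<in> P. f x = p x"
  using assms
proof (induction P rule: finite_linorder_max_induct)
  case empty
  then show ?case using rat_auts_id by auto
next
  case (insert b P)
  then have "strict_mono_on P p" by (auto simp: strict_mono_on_def)
  with insert obtain f where f: "f \<in> rat_auts" "\<And>x. x \<in> P \<Longrightarrow> f x = p x" by auto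
  then have fm: "strict_mono f" "bij f" by (auto simp: rat_auts_def)
  show ?case
  proof (cases "P = {}")
    case True
    have "(\<lambda>x. x + (p b - b)) \<in> rat_auts"
      by (auto simp: rat_auts_def strict_mono_def intro!: bij_betw_byWitness[where f'="\<lambda>x. x - (p b - b)"])
    then show ?thesis using True by (intro bexI[of _ "\<lambda>x. x + (p b - b)"]) auto
  next
    case False
    define a where "a = Max P"
    have a: "a \<in> P" "\<And>x. x \<in> P \<Longrightarrow> x \<le> a" "a < b"
      using insert.hyps False by (auto simp: a_def)
    have pab: "p a < p b" using insert.prems a by (auto simp: strict_mono_on_def)
    have fa: "f a = p a" using f a by auto
    define c where "c = (p b - p a) / (b - a)"
    have c: "c > 0" "c * (b - a) = p b - p a" using pab a by (auto simp: c_def)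
    define h where "h = (\<lambda>x. if x \<le> a then f x else p a + c * (x - a))"
    have mono: "h x < h y" if "x < y" for x y
    proof -
      consider "y \<le> a" | "x \<le> a" "a < y" | "a < x" by linarith
      then show ?thesis
      proof cases
        case 1
        then show ?thesis using that fm by (auto simp: h_def strict_mono_def)
      next
        case 2
        then have "f x \<le> p a" using fm fa by (metis strict_mono_less_eq)
        moreover have "0 < c * (y - a)" using c 2 by simp
        ultimately show ?thesis using 2 by (simp add: h_def)
      next
        case 3
        then show ?thesis using that c by (simp add: h_def)
      qed
    qed
    have surj: "\<exists>x. h x = y" for y
    proof (cases "y \<le> p a")
      case True
      obtain x where x: "f x = y" using fm(2) by (metis bij_pointE)
      then have "x \<le> a" using True fa fm(1) by (metis strict_mono_less_eq)
      then show ?thesis using x by (auto simp: h_def)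
    next
      case F: False
      have "0 < (y - p a) / c" using F c by simp
      then have "h (a + (y - p a) / c) = y" using c by (simp add: h_def)
      then show ?thesis by blast
    qed
    have "h \<in> rat_auts"
    proof -
      have "strict_mono h" using mono by (simp add: strict_mono_def)
      moreover have "surj h" using surj by (metis surjI surj_def)
      ultimately show ?thesis by (simp add: rat_auts_def bij_def strict_mono_imp_inj_on)
    qed
    moreover have "h b = p b" using a c by (simp add: h_def)
    moreover have "h x = p x" if "x \<in> P" for x using a that f by (simp add: h_def)
    ultimately show ?thesis by (intro bexI[of _ h]) auto
  qed
qed

lemma ex_strict_mono_on_image:
  fixes D X :: "'a::linorder set"
  assumes "finite D" "finite X" "card D = card X"
  shows "\<exists>p. strict_mono_on D p \<and> p ` D = X"
  using assms
proof (induction D arbitrary: X rule: finite_linorder_max_induct)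
  case empty
  then show ?case by (auto simp: strict_mono_on_def)
next
  case (insert b D)
  then have "X \<noteq> {}" by auto
  define m where "m = Max X"
  have m: "m \<in> X" "\<And>x. x \<in> X \<Longrightarrow> x \<le> m" using insert \<open>X \<noteq> {}\<close> by (auto simp: m_def)
  have "card D = card (X - {m})" using insert m by auto
  then obtain p where p: "strict_mono_on D p" "p ` D = X - {m}"
    using insert.IH[of "X - {m}"] insert.prems by auto
  have bD: "b \<notin> D" using insert.hyps by auto
  have "p x < m" if "x \<in> D" for x using p that m by (metis DiffE image_eqI insertI1 order_less_le)
  then have "strict_mono_on (insert b D) (p(b := m))"
    using p insert.hyps bD by (auto simp: strict_mono_on_def)
  moreover have "(p(b := m)) ` insert b D = X"
    using bD p m by (auto simp: image_iff)
  ultimately show ?case by blast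
qed

lemma rat_auts_homogeneous:
  assumes "finite D" "finite X" "card D = card X"
  shows "\<exists>f \<in> rat_auts. f ` D = X"
proof -
  obtain p where p: "strict_mono_on D p" "p ` D = X" using ex_strict_mono_on_image[OF assms] by blast
  then obtain f where "f \<in> rat_auts" "\<forall>x \<in> D. f x = p x" using strict_mono_on_rat_extends assms(1) by blast
  then show ?thesis using p by (intro bexI[of _ f]) auto
qed

text \<open>
  The largest point of \<open>D\<close> that is moved could go neither up, to a larger point, which is fixed,
  nor down, since its preimage would then be a larger point of \<open>D\<close>, which is fixed as well.
\<close>

lemma strict_mono_fixes_finite_invariant:
  fixes f :: "'a::linorder \<Rightarrow> 'a"
  assumes f: "strict_mono f" and D: "finite D" "f ` D = D" and "x \<in> D"
  shows "f x = x"
proof (rule ccontr)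
  assume "f x \<noteq> x"
  define m where "m = Max {x \<in> D. f x \<noteq> x}"
  have "m \<in> {x \<in> D. f x \<noteq> x}"
    unfolding m_def using D \<open>x \<in> D\<close> \<open>f x \<noteq> x\<close> by (intro Max_in) auto
  then have m: "m \<in> D" "f m \<noteq> m" by auto
  have big: "f y = y" if "y \<in> D" "m < y" for y
    using that D Max_ge[of "{x \<in> D. f x \<noteq> x}" y] by (force simp: m_def[symmetric])
  show False
  proof (cases "m < f m")
    case True
    then have "f (f m) = f m" using big m D by blast
    then show False using f True by (metis order_less_irrefl strict_mono_def)
  next
    case False
    then have "f m < m" using m by auto
    obtain y where y: "y \<in> D" "m = f y" using D m by blast
    then have "m < y" using f \<open>f m < m\<close> by (metis strict_mono_less)
    then have "f y = y" using big y by blast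
    then show False using y \<open>m < y\<close> by simp
  qed
qed

text \<open>
  This is Pestov's theorem that the group of increasing bijections of the rationals is extremely
  amenable.  Suppose that there is no fixed point.  By compactness, finitely many open sets \<open>W' i\<close>
  cover the space such that some \<open>h i\<close> maps a larger set \<open>W i\<close> off itself, where \<open>W i\<close> contains the
  image of \<open>W' i\<close> under every bijection that fixes a certain finite set \<open>E\<close> of rationals.  Take a base
  point \<open>y0\<close> and colour a set \<open>X\<close> of \<open>card E\<close> rationals by an \<open>i\<close> such that \<open>inv g y0\<close> lies in \<open>W' i\<close>
  for a chosen \<open>g\<close> with \<open>g ` E = X\<close>.  Any other \<open>f\<close> with \<open>f ` E = X\<close> differs from \<open>g\<close> by an element
  fixing \<open>E\<close>, so \<open>inv f y0\<close> lies in \<open>W i\<close>.  On a monochromatic set there is room for an image of both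
  \<open>E\<close> and \<open>inv (h i) ` E\<close> under one bijection \<open>k\<close>; then \<open>inv k y0\<close> and its image under \<open>h i\<close> both lie
  in \<open>W i\<close>, a contradiction.
  
  The hypothesis \<open>near\<close> expresses joint continuity at the identity for the topology of pointwise
  convergence.
\<close>

lemma rat_auts_extremely_amenable:
  fixes Y :: "'y topology" and a :: "(rat \<Rightarrow> rat) \<Rightarrow> 'y \<Rightarrow> 'y"
  assumes Y: "compact_space Y" "Hausdorff_space Y" "topspace Y \<noteq> {}"
    and cont: "\<And>f. f \<in> rat_auts \<Longrightarrow> continuous_map Y Y (a f)"
    and id: "\<And>y. y \<in> topspace Y \<Longrightarrow> a id y = y"
    and comp: "\<And>f g y. f \<in> rat_auts \<Longrightarrow> g \<in> rat_auts \<Longrightarrow> y \<in> topspace Y \<Longrightarrow> a (f \<circ> g) y = a f (a g y)"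
    and near: "\<And>y W. openin Y W \<Longrightarrow> y \<in> W \<Longrightarrow>
       \<exists>D W'. finite D \<and> openin Y W' \<and> y \<in> W' \<and>
         (\<forall>f \<in> rat_auts. (\<forall>q \<in> D. f q = q) \<longrightarrow> a f ` W' \<subseteq> W)"
  shows "\<exists>y \<in> topspace Y. \<forall>f \<in> rat_auts. a f y = y"
proof (rule ccontr)
  assume "\<not> ?thesis"
  then have mv: "\<exists>f \<in> rat_auts. a f y \<noteq> y" if "y \<in> topspace Y" for y using that by blast
  have inY: "a f y \<in> topspace Y" if "f \<in> rat_auts" "y \<in> topspace Y" for f y
    using cont[OF that(1)] that(2) by (auto simp: continuous_map_def Pi_iff)
  define Q where "Q y h W W' D \<longleftrightarrow> h \<in> rat_auts \<and> openin Y W' \<and> y \<in> W' \<and>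
      (\<forall>z \<in> W. a h z \<notin> W) \<and> finite D \<and>
      (\<forall>f \<in> rat_auts. (\<forall>q \<in> D. f q = q) \<longrightarrow> a f ` W' \<subseteq> W)" for y h W W' D
  have "\<exists>h W W' D. Q y h W W' D"
    if y: "y \<in> topspace Y" for y
  proof -
    obtain h where h: "h \<in> rat_auts" "a h y \<noteq> y" using mv[OF y] by blast
    obtain P Q where PQ: "openin Y P" "openin Y Q" "y \<in> P" "a h y \<in> Q" "disjnt P Q"
      using Y(2) y inY[OF h(1) y] h(2) unfolding Hausdorff_space_def by metis
    define W where "W = P \<inter> {z \<in> topspace Y. a h z \<in> Q}"
    have "openin Y W" unfolding W_def
      using PQ cont[OF h(1)] by (intro openin_Int openin_continuous_map_preimage) auto
    moreover have "y \<in> W" using PQ y by (auto simp: W_def)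
    ultimately obtain D W' where "finite D" "openin Y W'" "y \<in> W'"
         "\<forall>f \<in> rat_auts. (\<forall>q \<in> D. f q = q) \<longrightarrow> a f ` W' \<subseteq> W" using near by meson
    moreover have "\<forall>z \<in> W. a h z \<notin> W" using PQ by (auto simp: W_def disjnt_iff)
    ultimately show ?thesis using h unfolding Q_def by blast
  qed
  then obtain h W W' D where Q: "\<And>y. y \<in> topspace Y \<Longrightarrow> Q y (h y) (W y) (W' y) (D y)"
    by metis
  have h: "h y \<in> rat_auts" and W': "openin Y (W' y)" "y \<in> W' y"
    and W: "z \<in> W y \<Longrightarrow> a (h y) z \<notin> W y" and finD: "finite (D y)"
    if "y \<in> topspace Y" for y z
    using Q[OF that] by (simp_all add: Q_def)
  have D: "a f ` W' y \<subseteq> W y"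
    if "y \<in> topspace Y" "f \<in> rat_auts" "\<And>q. q \<in> D y \<Longrightarrow> f q = q" for y f
    using Q[OF that(1)] that(2,3) unfolding Q_def by blast
  have "topspace Y \<subseteq> \<Union>(W' ` topspace Y)" using W' by blast
  then obtain \<F> where "finite \<F>" "\<F> \<subseteq> W' ` topspace Y" "topspace Y \<subseteq> \<Union>\<F>"
    using Y(1)[unfolded compact_space_alt, rule_format, of "W' ` topspace Y"] W'(1) by auto
  then obtain I where I: "finite I" "I \<subseteq> topspace Y" "topspace Y \<subseteq> (\<Union>i\<in>I. W' i)"
    using finite_subset_image[of \<F> W' "topspace Y"] by auto
  define E where "E = (\<Union>i\<in>I. D i)"
  have E: "finite E" using I finD by (auto simp: E_def)
  obtain y0 where y0: "y0 \<in> topspace Y" using Y(3) by blast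
  obtain e :: "'y \<Rightarrow> nat" where e: "inj_on e I" "e ` I = {..<card I}"
    using ex_bij_betw_finite_nat[OF I(1)] by (auto simp: bij_betw_def atLeast0LessThan)
  define g where "g X = (SOME f. f \<in> rat_auts \<and> f ` E = X)" for X
  have g: "g X \<in> rat_auts" "g X ` E = X" if "finite X" "card X = card E" for X
    using someI_ex[of "\<lambda>f. f \<in> rat_auts \<and> f ` E = X"] rat_auts_homogeneous[OF E, of X] that
    by (auto simp: g_def)
  define y where "y X = a (inv_into UNIV (g X)) y0" for X
  define c where "c X = (SOME i. i \<in> I \<and> y X \<in> W' i)" for X
  have c: "c X \<in> I" "y X \<in> W' (c X)" if "finite X" "card X = card E" for X
  proof -
    have "y X \<in> topspace Y" using g[OF that] y0 inY rat_auts_inv by (simp add: y_def)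
    then have "\<exists>i. i \<in> I \<and> y X \<in> W' i" using I by blast
    from someI_ex[OF this] show "c X \<in> I" "y X \<in> W' (c X)" by (auto simp: c_def)
  qed
  have "infinite (UNIV :: rat set)" by (rule infinite_UNIV_char_0)
  moreover have "e (c X) < card I" if "X \<subseteq> UNIV \<and> finite X \<and> card X = card E" for X
    using c(1)[of X] that e by auto
  ultimately obtain H t where H: "infinite H" and hom: "\<And>X. X \<subseteq> H \<Longrightarrow> finite X \<Longrightarrow> card X = card E \<Longrightarrow> e (c X) = t"
    using Ramsey[of "UNIV :: rat set" "card E" "\<lambda>X. e (c X)" "card I"] by auto
  obtain X0 where X0: "X0 \<subseteq> H" "finite X0" "card X0 = card E" using infinite_arbitrarily_large[OF H] by metis
  define i where "i = c X0"
  have i: "i \<in> I" using c X0 by (simp add: i_def)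
  have ci: "c X = i" if "X \<subseteq> H" "finite X" "card X = card E" for X
    using hom[OF that] hom[OF X0] e(1) c(1)[of X] that i by (auto simp: i_def inj_on_def)
  \<comment> \<open>The colour of \<open>f ` E\<close> controls \<open>f\<close> itself up to an element \<open>u\<close> that fixes \<open>E\<close> pointwise.\<close>
  have inW: "a (inv_into UNIV f) y0 \<in> W i" if f: "f \<in> rat_auts" "f ` E \<subseteq> H" for f
  proof -
    let ?X = "f ` E"
    have X: "finite ?X" "card ?X = card E"
      using E rat_auts_inv[OF f(1)] by (auto intro: card_image inj_on_subset bij_is_inj)
    define u where "u = inv_into UNIV f \<circ> g ?X"
    have u: "u \<in> rat_auts" using g[OF X] f rat_auts_inv rat_auts_comp by (simp add: u_def)
    have "u ` E = inv_into UNIV f ` (g ?X ` E)" by (simp only: u_def image_comp)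
    also have "\<dots> = (inv_into UNIV f \<circ> f) ` E" by (simp only: g(2)[OF X] image_comp)
    finally have "u ` E = E" by (simp only: rat_auts_inv(2)[OF f(1)] image_id id_apply)
    then have "u q = q" if "q \<in> E" for q
      using strict_mono_fixes_finite_invariant[of u E q] u E that by (auto simp: rat_auts_def)
    then have "a u ` W' i \<subseteq> W i" using D[of i u] u i I by (auto simp: E_def)
    moreover have "y ?X \<in> W' i" using c(2)[OF X] ci[OF f(2) X] by simp
    ultimately have "a u (y ?X) \<in> W i" by blast
    also have "a u (y ?X) = a (u \<circ> inv_into UNIV (g ?X)) y0"
      using comp u rat_auts_inv(1) g[OF X] y0 by (simp add: y_def)
    also have "u \<circ> inv_into UNIV (g ?X) = inv_into UNIV f" using rat_auts_inv(3)[OF g(1)[OF X]] by (simp add: u_def o_assoc[symmetric])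
    finally show ?thesis .
  qed
  let ?h = "h i"
  have hi: "?h \<in> rat_auts" using h i I by auto
  define E' where "E' = E \<union> inv_into UNIV ?h ` E"
  have "finite E'" using E by (simp add: E'_def)
  obtain X where X: "X \<subseteq> H" "finite X" "card X = card E'" using infinite_arbitrarily_large[OF H] by metis
  then obtain k where k: "k \<in> rat_auts" "k ` E' = X"
    using rat_auts_homogeneous[OF \<open>finite E'\<close>, of X] by auto
  have "a (inv_into UNIV k) y0 \<in> W i" using inW[OF k(1)] k X by (auto simp: E'_def)
  moreover have "a (inv_into UNIV (k \<circ> inv_into UNIV ?h)) y0 \<in> W i"
    using inW[of "k \<circ> inv_into UNIV ?h"] k X hi rat_auts_comp rat_auts_inv by (auto simp: E'_def)
  moreover have "inv_into UNIV (k \<circ> inv_into UNIV ?h) = ?h \<circ> inv_into UNIV k"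
    using o_inv_distrib[of k "inv_into UNIV ?h"] rat_auts_inv(4) k hi by (simp add: bij_imp_bij_inv inv_inv_eq)
  ultimately show False using W[of i "a (inv_into UNIV k) y0"] comp[OF hi rat_auts_inv(1)[OF k(1)] y0] i I by auto
qed

section \<open>The ultrametric space and its isometries\<close>

locale distance_set =
  fixes S :: "real set"
  assumes pos: "S \<subseteq> {0<..}"
begin

abbreviation "B \<equiv> B_pts S"
abbreviation "d \<equiv> B_dist S"
abbreviation "G \<equiv> iso_group S"

lemma d_self [simp]: "d x x = 0"
  by (simp add: B_dist_def)

lemma d_nonneg [simp]: "0 \<le> d x y"
  by (rule B_dist_nonneg[OF pos])

lemma d_in_S: "x \<in> B \<Longrightarrow> y \<in> B \<Longrightarrow> x \<noteq> y \<Longrightarrow> d x y \<in> S"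
  by (rule B_dist_in)

lemma S_pos: "s \<in> S \<Longrightarrow> 0 < s"
  using pos by auto

lemma d_le_iff:
  assumes "x \<in> B" "y \<in> B" "0 \<le> t"
  shows "d x y \<le> t \<longleftrightarrow> (\<forall>s \<in> S. t < s \<longrightarrow> x s = y s)"
proof (cases "x = y")
  case False
  then show ?thesis
    using B_dist_in[of x S y] B_dist_ge[of x S y] assms by (meson leD leI order_trans)
qed (use assms in simp)

lemma d_cong:
  assumes "x \<in> B" "y \<in> B" "x' \<in> B" "y' \<in> B" "\<And>s. s \<in> S \<Longrightarrow> x s = y s \<longleftrightarrow> x' s = y' s"
  shows "d x y = d x' y'"
  using d_le_iff[OF assms(1,2), of "d x' y'"] d_le_iff[OF assms(3,4), of "d x' y'"]
    d_le_iff[OF assms(1,2), of "d x y"] d_le_iff[OF assms(3,4), of "d x y"] assms(5)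
  by (intro antisym) auto

text \<open>
  The two longest sides of an ultrametric triangle are equal.
\<close>

lemma isosceles:
  assumes "x \<in> B" "x' \<in> B" "y \<in> B" "d x x' < d x y"
  shows "d x' y = d x y"
  using B_dist_ultrametric[OF pos assms(1,2,3)] B_dist_ultrametric[OF pos assms(2,1,3)] assms(4)
    B_dist_commute[of S x x'] by linarith

lemma fun_upd_in_B: "x \<in> B \<Longrightarrow> t \<in> S \<Longrightarrow> x(t := v) \<in> B"
proof -
  assume a: "x \<in> B" "t \<in> S"
  have "{s \<in> S. (x(t := v)) s \<noteq> 0} \<subseteq> insert t {s \<in> S. x s \<noteq> 0}" by auto
  moreover have "finite (insert t {s \<in> S. x s \<noteq> 0})" using a(1) by (simp add: B_pts_def)
  ultimately have "finite {s \<in> S. (x(t := v)) s \<noteq> 0}" by (rule finite_subset)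
  moreover have "x(t := v) \<in> S \<rightarrow>\<^sub>E UNIV" using a by (auto simp: B_pts_def PiE_def extensional_def)
  ultimately show ?thesis by (simp add: B_pts_def)
qed

lemma d_fun_upd_le: "x \<in> B \<Longrightarrow> t \<in> S \<Longrightarrow> d x (x(t := v)) \<le> t"
  using d_le_iff[of x "x(t := v)" t] fun_upd_in_B[of x t v] S_pos[of t] by auto

lemma B_nonempty: "(\<lambda>s\<in>S. 0) \<in> B"
proof -
  have "{s \<in> S. (\<lambda>s\<in>S. 0::rat) s \<noteq> 0} = {}" by auto
  then show ?thesis by (simp add: B_pts_def)
qed

lemma iso_iff:
  "g \<in> carrier G \<longleftrightarrow> g \<in> Bij B \<and> (\<forall>x \<in> B. \<forall>y \<in> B. d (g x) (g y) = d x y)"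
  by (simp add: iso_group_def)

lemma subgroup_iso: "subgroup (carrier G) (BijGroup B)"
proof (rule group.subgroupI[OF group_BijGroup])
  show "carrier G \<subseteq> carrier (BijGroup B)" by (auto simp: iso_iff BijGroup_def)
  show "carrier G \<noteq> {}" using id_Bij[of B] iso_iff[of "\<lambda>x\<in>B. x"] by auto
next
  fix g h assume g: "g \<in> carrier G" and h: "h \<in> carrier G"
  then have "compose B g h \<in> carrier G"
    using compose_Bij[of g B h] Bij_imp_funcset[of h B] by (auto simp: iso_iff compose_def Pi_iff)
  then show "g \<otimes>\<^bsub>BijGroup B\<^esub> h \<in> carrier G" using g h by (simp add: BijGroup_def iso_iff)
next
  fix g assume g: "g \<in> carrier G"
  then have gB: "g \<in> Bij B" by (simp add: iso_iff)
  then have *: "inv_into B g x \<in> B" "g (inv_into B g x) = x" if "x \<in> B" for x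
    using that by (auto simp: Bij_def bij_betw_def f_inv_into_f intro: inv_into_into)
  have "restrict (inv_into B g) B \<in> carrier G"
    unfolding iso_iff
  proof (intro conjI ballI)
    fix x y assume "x \<in> B" "y \<in> B"
    then show "d (restrict (inv_into B g) B x) (restrict (inv_into B g) B y) = d x y"
      using g * by (metis iso_iff restrict_apply')
  qed (rule restrict_inv_into_Bij[OF gB])
  then show "inv\<^bsub>BijGroup B\<^esub> g \<in> carrier G" by (simp add: inv_BijGroup[OF gB])
qed

lemma group_G: "group G"
proof -
  have "G = BijGroup B \<lparr>carrier := carrier G\<rparr>" by (simp add: iso_group_def)
  then show ?thesis using subgroup.subgroup_is_group[OF subgroup_iso group_BijGroup] by metis
qed

sublocale G: group G by (rule group_G)

lemma mult_apply:
  assumes "g \<in> carrier G" "h \<in> carrier G" "x \<in> B"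
  shows "(g \<otimes>\<^bsub>G\<^esub> h) x = g (h x)"
  using assms by (simp add: iso_group_def BijGroup_def compose_def)

lemma one_apply: "x \<in> B \<Longrightarrow> \<one>\<^bsub>G\<^esub> x = x"
  by (simp add: iso_group_def BijGroup_def)

lemma G_in: "g \<in> carrier G \<Longrightarrow> x \<in> B \<Longrightarrow> g x \<in> B"
  using Bij_imp_funcset by (fastforce simp: iso_iff)

lemma G_isometry: "g \<in> carrier G \<Longrightarrow> x \<in> B \<Longrightarrow> y \<in> B \<Longrightarrow> d (g x) (g y) = d x y"
  by (simp add: iso_iff)

lemma inv_apply:
  assumes "g \<in> carrier G" "x \<in> B"
  shows "(inv\<^bsub>G\<^esub> g) (g x) = x" "g ((inv\<^bsub>G\<^esub> g) x) = x"
  using mult_apply[of "inv\<^bsub>G\<^esub> g" g x] mult_apply[of g "inv\<^bsub>G\<^esub> g" x] assms one_apply by auto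

lemma G_inj: "g \<in> carrier G \<Longrightarrow> x \<in> B \<Longrightarrow> y \<in> B \<Longrightarrow> g x = g y \<longleftrightarrow> x = y"
  using inv_apply(1) by metis

lemma G_ext:
  assumes "g \<in> carrier G" "h \<in> carrier G" "\<And>x. x \<in> B \<Longrightarrow> g x = h x"
  shows "g = h"
  using assms by (intro extensionalityI[of g B]) (auto simp: iso_iff Bij_def)

end

section \<open>Moves and the lexicographic ordering\<close>

text \<open>
  The condition on \<open>d x c\<close> says that \<open>x\<close> and \<open>c\<close> agree in all coordinates above \<open>t\<close>.
\<close>

definition move :: "real set \<Rightarrow> real \<Rightarrow> point \<Rightarrow> (rat \<Rightarrow> rat) \<Rightarrow> point \<Rightarrow> point" where
  "move S t c f = (\<lambda>x \<in> B_pts S. if B_dist S x c \<le> t then x(t := f (x t)) else x)"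

definition lex_order :: "real set \<Rightarrow> point rel" where
  "lex_order S = {(x, y) \<in> B_pts S \<times> B_pts S. x \<noteq> y \<and> x (B_dist S x y) < y (B_dist S x y)}"

context distance_set
begin

abbreviation "mv \<equiv> move S"
abbreviation "lexo \<equiv> lex_order S"

lemma move_apply: "x \<in> B \<Longrightarrow> mv t c f x = (if d x c \<le> t then x(t := f (x t)) else x)"
  by (simp add: move_def)

lemma move_in: "x \<in> B \<Longrightarrow> t \<in> S \<Longrightarrow> mv t c f x \<in> B"
  by (simp add: move_apply fun_upd_in_B)

text \<open>
  A move stays inside its ball, so moves of one ball compose like the functions that they apply.
\<close>

lemma d_move_center:
  assumes "x \<in> B" "t \<in> S" "c \<in> B"
  shows "d (mv t c f x) c \<le> t \<longleftrightarrow> d x c \<le> t"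
  using assms S_pos[of t] by (simp add: move_apply d_le_iff fun_upd_in_B)

lemma move_comp:
  assumes "x \<in> B" "t \<in> S" "c \<in> B"
  shows "mv t c f (mv t c g x) = mv t c (f \<circ> g) x"
  using assms d_move_center[OF assms, of g] move_in[OF assms(1,2), of c g]
  by (simp add: move_apply)

text \<open>
  Points inside the ball keep the coordinates where they differ, as \<open>f\<close> is injective; a point
  outside is further away from the ball than the diameter of the ball.
\<close>

lemma move_isometry:
  assumes "x \<in> B" "y \<in> B" "t \<in> S" "c \<in> B" "inj f"
  shows "d (mv t c f x) (mv t c f y) = d x y"
proof -
  have far: "d (mv t c f x) (mv t c f y) = d x y"
    if "x \<in> B" "y \<in> B" "d x c \<le> t" "\<not> d y c \<le> t" for x y
  proof -
    have "d x y > t"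
      using B_dist_ultrametric[OF pos, of y x c] that assms B_dist_commute[of S x y] by auto
    then show ?thesis
      using isosceles[of x "x(t := f (x t))" y] d_fun_upd_le[of x t] that assms fun_upd_in_B
      by (auto simp: move_apply intro: le_less_trans)
  qed
  consider "d x c \<le> t" "d y c \<le> t" | "d x c \<le> t" "\<not> d y c \<le> t"
    | "\<not> d x c \<le> t" "d y c \<le> t" | "\<not> d x c \<le> t" "\<not> d y c \<le> t" by blast
  then show ?thesis
  proof cases
    case 1
    then show ?thesis
      using assms by (intro d_cong) (auto simp: move_apply fun_upd_in_B inj_eq)
  next
    case 3
    then show ?thesis using far[of y x] assms by (simp add: B_dist_commute)
  qed (use far assms in \<open>auto simp: move_apply\<close>)
qed

lemma move_in_G:
  assumes "t \<in> S" "c \<in> B" "bij f"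
  shows "mv t c f \<in> carrier G"
  unfolding iso_iff
proof
  have "bij_betw (mv t c f) B B"
  proof (rule bij_betw_byWitness[where f'="mv t c (inv_into UNIV f)"])
    have *: "inv_into UNIV f \<circ> f = id" "f \<circ> inv_into UNIV f = id"
      using assms(3) by (auto simp: bij_is_inj bij_is_surj surj_f_inv_f)
    have id: "mv t c id x = x" if "x \<in> B" for x using that by (simp add: move_apply)
    show "\<forall>x\<in>B. mv t c (inv_into UNIV f) (mv t c f x) = x" "\<forall>x\<in>B. mv t c f (mv t c (inv_into UNIV f) x) = x"
      using assms move_comp id * by auto
  qed (use assms move_in in auto)
  then show "mv t c f \<in> Bij B" by (simp add: Bij_def move_def)
  show "\<forall>x\<in>B. \<forall>y\<in>B. d (mv t c f x) (mv t c f y) = d x y"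
    using move_isometry assms bij_is_inj by blast
qed

lemma move_mult:
  assumes "t \<in> S" "c \<in> B" "bij f" "bij g"
  shows "mv t c f \<otimes>\<^bsub>G\<^esub> mv t c g = mv t c (f \<circ> g)"
  using assms move_in_G bij_comp[of g f]
  by (intro G_ext) (auto simp: mult_apply move_comp)

lemma move_id: "t \<in> S \<Longrightarrow> c \<in> B \<Longrightarrow> mv t c id = \<one>\<^bsub>G\<^esub>"
  by (intro G_ext) (auto simp: move_in_G one_apply, simp add: move_apply)

lemma lex_iff: "(x, y) \<in> lexo \<longleftrightarrow> x \<in> B \<and> y \<in> B \<and> x \<noteq> y \<and> x (d x y) < y (d x y)"
  by (auto simp: lex_order_def)

lemma lex_total: "x \<in> B \<Longrightarrow> y \<in> B \<Longrightarrow> x \<noteq> y \<Longrightarrow> (x, y) \<in> lexo \<longleftrightarrow> (y, x) \<notin> lexo"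
  using B_dist_in(2)[of x S y] by (auto simp: lex_iff B_dist_commute[of S y x])

text \<open>
  The relative position of two points is read off at the coordinate \<open>d x y\<close>, where a move
  either does nothing or, if \<open>d x y = t\<close>, applies the increasing \<open>f\<close> to both points or to none.
\<close>

lemma move_lex:
  assumes "x \<in> B" "y \<in> B" "t \<in> S" "c \<in> B" "f \<in> rat_auts" "(x, y) \<in> lexo"
  shows "(mv t c f x, mv t c f y) \<in> lexo"
proof -
  have f: "bij f" "strict_mono f" using assms(5) by (auto simp: rat_auts_def)
  have iso: "d (mv t c f x) (mv t c f y) = d x y"
    using move_isometry assms f bij_is_inj by blast
  have xy: "x \<noteq> y" "x (d x y) < y (d x y)" using assms by (auto simp: lex_iff)
  have "d x c \<le> t \<longleftrightarrow> d y c \<le> t" if "d x y = t"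
    using B_dist_ultrametric[OF pos, of y x c] B_dist_ultrametric[OF pos, of x y c]
      B_dist_commute[of S x y] assms that by auto
  then have "mv t c f x (d x y) < mv t c f y (d x y)"
    using xy assms f by (auto simp: move_apply strict_mono_less)
  moreover have "mv t c f x \<noteq> mv t c f y"
    using G_inj[OF move_in_G[OF assms(3,4) f(1)]] assms xy by auto
  ultimately show ?thesis using iso assms move_in by (simp add: lex_iff)
qed

text \<open>
  Conjugation by the move at level \<open>t'\<close> about \<open>c'\<close> turns the moves about the ball of \<open>c\<^sub>0\<close> into
  those about its image.  The last hypothesis covers both uses: a higher level \<open>t'\<close>, and
  a disjoint ball of the same level, where the two moves commute.
\<close>

lemma move_conj:
  assumes "x \<in> B" "t \<in> S" "c \<in> B" "t' \<in> S" "c' \<in> B" "bij f" "c\<^sub>0 \<in> B" "mv t' c' f c\<^sub>0 = c"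
    and "t < t' \<or> t = t' \<and> \<not> d c\<^sub>0 c' \<le> t"
  shows "mv t c g (mv t' c' f x) = mv t' c' f (mv t c\<^sub>0 g x)"
proof -
  have t0: "0 < t" "0 < t'" using assms S_pos by auto
  have iso: "d (mv t' c' f x) c = d x c\<^sub>0"
    using move_isometry[OF assms(1,7,4,5) bij_is_inj[OF assms(6)]] assms(8) by simp
  have outer: "mv t c g (mv t' c' f x) =
      (if d x c\<^sub>0 \<le> t then (mv t' c' f x)(t := g (mv t' c' f x t)) else mv t' c' f x)"
    using move_apply[of "mv t' c' f x" t c g] move_in[OF assms(1,4), of c' f] iso by simp
  show ?thesis
  proof (cases "d x c\<^sub>0 \<le> t")
    case False
    then show ?thesis using outer move_apply[OF assms(1), of t c\<^sub>0 g] by simp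
  next
    case True
    have upd: "x(t := v) \<in> B" for v using assms fun_upd_in_B by auto
    \<comment> \<open>Membership in the ball of the outer move depends on coordinates above \<open>t' \<ge> t\<close> only.\<close>
    have same: "d (x(t := v)) c' \<le> t' \<longleftrightarrow> d x c' \<le> t'" for v
      using assms(9) t0 upd assms by (auto simp: d_le_iff)
    have diff: "t \<noteq> t'" if "d x c' \<le> t'"
    proof
      assume "t = t'"
      then have "d c\<^sub>0 c' \<le> t"
        using B_dist_ultrametric[OF pos, of c\<^sub>0 x c'] True that assms B_dist_commute[of S x c\<^sub>0] by auto
      then show False using assms(9) \<open>t = t'\<close> by auto
    qed
    have "mv t c g (mv t' c' f x) = (mv t' c' f x)(t := g (mv t' c' f x t))"
      using True outer by simp
    also have "\<dots> = mv t' c' f (x(t := g (x t)))"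
      using upd same diff assms by (auto simp: move_apply fun_upd_twist)
    finally show ?thesis using True move_apply[OF assms(1), of t c\<^sub>0 g] by simp
  qed
qed

end

section \<open>The isometry group as a topological group\<close>

lemma continuous_map_from_prodI:
  assumes "\<And>x y. x \<in> topspace X \<Longrightarrow> y \<in> topspace Y \<Longrightarrow> f (x, y) \<in> topspace Z"
    and "\<And>x y W. x \<in> topspace X \<Longrightarrow> y \<in> topspace Y \<Longrightarrow> openin Z W \<Longrightarrow> f (x, y) \<in> W \<Longrightarrow>
      \<exists>U V. openin X U \<and> openin Y V \<and> x \<in> U \<and> y \<in> V \<and> (\<forall>u \<in> U. \<forall>v \<in> V. f (u, v) \<in> W)"
  shows "continuous_map (prod_topology X Y) Z f"
  unfolding continuous_map_def
proof (intro conjI allI impI)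
  show "f \<in> topspace (prod_topology X Y) \<rightarrow> topspace Z" using assms(1) by auto
next
  fix W assume W: "openin Z W"
  show "openin (prod_topology X Y) {p \<in> topspace (prod_topology X Y). f p \<in> W}"
    unfolding openin_prod_topology_alt
  proof clarify
    fix x y assume "(x, y) \<in> topspace (prod_topology X Y)" "f (x, y) \<in> W"
    then obtain U V where UV: "openin X U" "openin Y V" "x \<in> U" "y \<in> V"
      "\<forall>u \<in> U. \<forall>v \<in> V. f (u, v) \<in> W"
      using assms(2)[of x y W] W by auto
    then have "U \<times> V \<subseteq> {p \<in> topspace (prod_topology X Y). f p \<in> W}"
      using openin_subset[OF UV(1)] openin_subset[OF UV(2)] by auto
    with UV show "\<exists>U V. openin X U \<and> openin Y V \<and> x \<in> U \<and> y \<in> V \<and>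
        U \<times> V \<subseteq> {p \<in> topspace (prod_topology X Y). f p \<in> W}"
      by blast
  qed
qed

context distance_set
begin

lemma G_subset_PiE: "carrier G \<subseteq> B \<rightarrow>\<^sub>E B"
proof
  fix g assume "g \<in> carrier G"
  then have "g \<in> Bij B" by (simp add: iso_iff)
  then show "g \<in> B \<rightarrow>\<^sub>E B" using Bij_imp_funcset[of g B] Bij_imp_extensional[of g B] by (simp add: PiE_def)
qed

lemma topspace_iso [simp]: "topspace (iso_topology S) = carrier G"
  using G_subset_PiE by (auto simp: iso_topology_def)

text \<open>
  Agreement on a finite set is the only way in which the topology of pointwise convergence is used.
\<close>

lemma openin_iso_iff:
  "openin (iso_topology S) U \<longleftrightarrow> U \<subseteq> carrier G \<and>
     (\<forall>g \<in> U. \<exists>D. finite D \<and> D \<subseteq> B \<and> (\<forall>h \<in> carrier G. (\<forall>x \<in> D. h x = g x) \<longrightarrow> h \<in> U))"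
    (is "_ \<longleftrightarrow> _ \<and> ?R")
proof -
  let ?P = "product_topology (\<lambda>_. discrete_topology B) B"
  show ?thesis
  proof (intro iffI conjI)
    assume "openin (iso_topology S) U"
    then obtain V where V: "openin ?P V" "U = V \<inter> carrier G"
      by (auto simp: iso_topology_def openin_subtopology)
    show "U \<subseteq> carrier G" using V by auto
    show ?R
    proof
      fix g assume "g \<in> U"
      then have "g \<in> V" using V by auto
      then obtain N where N: "finite {i \<in> B. N i \<noteq> B}" "g \<in> Pi\<^sub>E B N" "Pi\<^sub>E B N \<subseteq> V"
        using V(1) unfolding openin_product_topology_alt by auto
      show "\<exists>D. finite D \<and> D \<subseteq> B \<and> (\<forall>h \<in> carrier G. (\<forall>x \<in> D. h x = g x) \<longrightarrow> h \<in> U)"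
      proof (intro exI[of _ "{i \<in> B. N i \<noteq> B}"] conjI ballI impI)
        fix h assume h: "h \<in> carrier G" "\<forall>x\<in>{i \<in> B. N i \<noteq> B}. h x = g x"
        have "h \<in> Pi\<^sub>E B N"
        proof (rule PiE_I)
          fix x assume "x \<in> B"
          then show "h x \<in> N x" using h N(2) G_in[OF h(1)] by (cases "N x = B") auto
        next
          fix x assume "x \<notin> B"
          then show "h x = undefined" using h(1) G_subset_PiE by (auto simp: PiE_def extensional_def)
        qed
        then show "h \<in> U" using N(3) V(2) h(1) by auto
      qed (use N in auto)
    qed
  next
    assume R: "U \<subseteq> carrier G \<and> ?R"
    then obtain D where D: "\<And>g. g \<in> U \<Longrightarrow> finite (D g) \<and> D g \<subseteq> B \<and>
        (\<forall>h \<in> carrier G. (\<forall>x \<in> D g. h x = g x) \<longrightarrow> h \<in> U)" by metis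
    define N where "N g = Pi\<^sub>E B (\<lambda>x. if x \<in> D g then {g x} else B)" for g
    have "openin ?P (N g)" if "g \<in> U" for g
    proof -
      have "{i \<in> B. (if i \<in> D g then {g i} else B) \<noteq> B} \<subseteq> D g" by auto
      then have "finite {i \<in> B. (if i \<in> D g then {g i} else B) \<noteq> B}"
        using D[OF that] finite_subset by blast
      then show ?thesis unfolding N_def openin_PiE_gen
        using D[OF that] R that G_in by (auto simp: subset_iff)
    qed
    then have "openin ?P (\<Union>g\<in>U. N g)" by auto
    moreover have "U = (\<Union>g\<in>U. N g) \<inter> carrier G"
    proof
      show "U \<subseteq> (\<Union>g\<in>U. N g) \<inter> carrier G"
      proof
        fix g assume g: "g \<in> U"
        then have "g \<in> B \<rightarrow>\<^sub>E B" "g \<in> carrier G" using R G_subset_PiE by auto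
        then have "g \<in> N g" by (simp add: N_def PiE_iff)
        then show "g \<in> (\<Union>g\<in>U. N g) \<inter> carrier G" using g \<open>g \<in> carrier G\<close> by blast
      qed
      show "(\<Union>g\<in>U. N g) \<inter> carrier G \<subseteq> U"
      proof clarify
        fix g h assume gh: "g \<in> U" "h \<in> N g" "h \<in> carrier G"
        have "h x = g x" if "x \<in> D g" for x
        proof -
          have "x \<in> B" using that D[OF gh(1)] by auto
          then show ?thesis using gh(2) that by (auto simp: N_def PiE_iff dest!: bspec)
        qed
        then show "h \<in> U" using D[OF gh(1)] gh(3) by auto
      qed
    qed
    ultimately show "openin (iso_topology S) U"
      unfolding iso_topology_def openin_subtopology by blast
  qed
qed

lemma openin_iso_nbhd:
  assumes "finite D" "D \<subseteq> B"
  shows "openin (iso_topology S) {h \<in> carrier G. \<forall>x \<in> D. h x = g x}"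
  unfolding openin_iso_iff using assms by auto

lemma openin_isoD:
  assumes "openin (iso_topology S) W" "g \<in> W"
  shows "\<exists>D. finite D \<and> D \<subseteq> B \<and> (\<forall>h \<in> carrier G. (\<forall>x \<in> D. h x = g x) \<longrightarrow> h \<in> W)"
  using assms by (simp add: openin_iso_iff)

lemma topological_group_iso: "topological_group G (iso_topology S)"
  unfolding topological_group_def
proof (intro conjI)
  show "continuous_map (prod_topology (iso_topology S) (iso_topology S)) (iso_topology S)
      (\<lambda>(g, h). g \<otimes>\<^bsub>G\<^esub> h)"
  proof (rule continuous_map_from_prodI)
    fix g h W
    assume gh: "g \<in> topspace (iso_topology S)" "h \<in> topspace (iso_topology S)"
      and W: "openin (iso_topology S) W" "(case (g, h) of (g, h) \<Rightarrow> g \<otimes>\<^bsub>G\<^esub> h) \<in> W"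
    obtain D where D: "finite D" "D \<subseteq> B"
      "\<forall>k \<in> carrier G. (\<forall>x \<in> D. k x = (g \<otimes>\<^bsub>G\<^esub> h) x) \<longrightarrow> k \<in> W"
      using openin_isoD[OF W(1) W(2)[unfolded prod.case]] by (elim exE conjE)
    have hD: "h ` D \<subseteq> B" using D gh G_in by auto
    show "\<exists>U V. openin (iso_topology S) U \<and> openin (iso_topology S) V \<and> g \<in> U \<and> h \<in> V \<and>
        (\<forall>u\<in>U. \<forall>v\<in>V. (case (u, v) of (g, h) \<Rightarrow> g \<otimes>\<^bsub>G\<^esub> h) \<in> W)"
      using gh D openin_iso_nbhd[of "h ` D" g] openin_iso_nbhd[of D h] hD
      by (intro exI[of _ "{k \<in> carrier G. \<forall>x \<in> h ` D. k x = g x}"]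
          exI[of _ "{k \<in> carrier G. \<forall>x \<in> D. k x = h x}"])
        (auto simp: mult_apply subset_iff intro!: D(3)[rule_format])
  qed auto
  show "continuous_map (iso_topology S) (iso_topology S) (\<lambda>g. inv\<^bsub>G\<^esub> g)"
    unfolding continuous_map_def
  proof (intro conjI allI impI)
    fix W assume W: "openin (iso_topology S) W"
    show "openin (iso_topology S) {g \<in> topspace (iso_topology S). inv\<^bsub>G\<^esub> g \<in> W}"
      unfolding openin_iso_iff
    proof (intro conjI ballI)
      fix g assume "g \<in> {g \<in> topspace (iso_topology S). inv\<^bsub>G\<^esub> g \<in> W}"
      then have g: "g \<in> carrier G" "inv\<^bsub>G\<^esub> g \<in> W" by auto
      obtain D where D: "finite D" "D \<subseteq> B"
        "\<forall>k \<in> carrier G. (\<forall>x \<in> D. k x = (inv\<^bsub>G\<^esub> g) x) \<longrightarrow> k \<in> W"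
        using openin_isoD[OF W g(2)] by (elim exE conjE)
      show "\<exists>D. finite D \<and> D \<subseteq> B \<and> (\<forall>h\<in>carrier G. (\<forall>x\<in>D. h x = g x) \<longrightarrow>
           h \<in> {g \<in> topspace (iso_topology S). inv\<^bsub>G\<^esub> g \<in> W})"
      proof (intro exI[of _ "(inv\<^bsub>G\<^esub> g) ` D"] conjI ballI impI)
        fix h assume h: "h \<in> carrier G" "\<forall>x\<in>(inv\<^bsub>G\<^esub> g) ` D. h x = g x"
        have "(inv\<^bsub>G\<^esub> h) x = (inv\<^bsub>G\<^esub> g) x" if "x \<in> D" for x
        proof -
          have x: "x \<in> B" "(inv\<^bsub>G\<^esub> g) x \<in> B" using that D g G_in[of "inv\<^bsub>G\<^esub> g"] by auto
          then have "h ((inv\<^bsub>G\<^esub> g) x) = x" using h that inv_apply(2)[OF g(1)] by auto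
          then show ?thesis using inv_apply(1)[OF h(1) x(2)] by simp
        qed
        then show "h \<in> {g \<in> topspace (iso_topology S). inv\<^bsub>G\<^esub> g \<in> W}" using D(3) h by auto
      qed (use D g G_in[of "inv\<^bsub>G\<^esub> g"] in auto)
    qed auto
  qed auto
qed (auto simp: group_G)

section \<open>The flow of convex linear orderings\<close>

text \<open>
  All balls are convex exactly when a point cannot separate two points that are closer to
  each other than to it.  The two clauses carry this condition in the form used below: replacing \<open>x\<close>
  by a point closer to \<open>x\<close> than \<open>z\<close> does not change the position of \<open>z\<close>.
\<close>

lemma cLO_iff:
  "r \<in> cLO S \<longleftrightarrow> r \<subseteq> B \<times> B \<and> irrefl r \<and> trans r \<and> total_on B r \<and>
     (\<forall>x \<in> B. \<forall>y \<in> B. \<forall>z \<in> B. d x y < d x z \<longrightarrow> (x, z) \<in> r \<longrightarrow> (y, z) \<in> r) \<and>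
     (\<forall>x \<in> B. \<forall>y \<in> B. \<forall>z \<in> B. d x y < d x z \<longrightarrow> (z, x) \<in> r \<longrightarrow> (z, y) \<in> r)"
    (is "_ \<longleftrightarrow> ?O \<and> ?irr \<and> ?tr \<and> ?tot \<and> ?L \<and> ?R")
proof
  interpret M: Metric_space B d by (rule Metric_space_B[OF pos])
  assume "r \<in> cLO S"
  then have o: ?O ?irr ?tr ?tot
    and cv: "\<And>x t. x \<in> B \<Longrightarrow> order_convex B r (M.mball x t)"
    by (auto simp: cLO_def strict_linear_order_on_def)
  have "z \<notin> M.mball x (d x z)" "x \<in> M.mball x (d x z)" "y \<in> M.mball x (d x z)"
    if "x \<in> B" "y \<in> B" "z \<in> B" "d x y < d x z" for x y z
    using that d_nonneg[of x y] by (auto simp del: d_nonneg)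
  moreover have "y \<noteq> z" if "d x y < d x z" for x y z using that by auto
  ultimately have ?L ?R
    using cv o(4) unfolding order_convex_def total_on_def by meson+
  then show "?O \<and> ?irr \<and> ?tr \<and> ?tot \<and> ?L \<and> ?R" using o by blast
next
  interpret M: Metric_space B d by (rule Metric_space_B[OF pos])
  assume *: "?O \<and> ?irr \<and> ?tr \<and> ?tot \<and> ?L \<and> ?R"
  have key: False if "x \<in> B" "y \<in> B" "z \<in> B" "(x, z) \<in> r" "(z, y) \<in> r" "d x y < d x z" for x y z
    using that * unfolding irrefl_def trans_def by meson
  have ball: "d x y \<le> max (d c x) (d c y)" "d c z \<le> max (d c x) (d x z)"
    if "x \<in> B" "y \<in> B" "c \<in> B" "z \<in> B" for c x y z
    using B_dist_ultrametric[OF pos, of x c y] B_dist_ultrametric[OF pos, of c x z] that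
      B_dist_commute[of S c x] by auto
  have "order_convex B r (M.mball c t) \<and> order_convex B r (M.mcball c t)" if c: "c \<in> B" for c t
    unfolding order_convex_def
  proof (intro conjI ballI impI)
    fix x y z assume a: "x \<in> M.mball c t" "y \<in> M.mball c t" "z \<in> B" "(x, z) \<in> r \<and> (z, y) \<in> r"
    then have "\<not> d x y < d x z" using key[of x y z] by auto
    then have "d c z < t" using ball[of x y c z] a by auto
    then show "z \<in> M.mball c t" using a c by auto
  next
    fix x y z assume a: "x \<in> M.mcball c t" "y \<in> M.mcball c t" "z \<in> B" "(x, z) \<in> r \<and> (z, y) \<in> r"
    then have "\<not> d x y < d x z" using key[of x y z] by auto
    then have "d c z \<le> t" using ball[of x y c z] a by auto
    then show "z \<in> M.mcball c t" using a c by auto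
  qed
  then show "r \<in> cLO S" using * by (simp add: cLO_def strict_linear_order_on_def)
qed

lemma cLO_subset: "r \<in> cLO S \<Longrightarrow> r \<subseteq> B \<times> B"
  by (simp add: cLO_def)

lemma cLO_irrefl: "r \<in> cLO S \<Longrightarrow> (x, x) \<notin> r"
  by (simp add: cLO_iff irrefl_def)

lemma cLO_asym: "r \<in> cLO S \<Longrightarrow> (x, y) \<in> r \<Longrightarrow> (y, x) \<notin> r"
  unfolding cLO_iff irrefl_def trans_def by meson

lemma cLO_total: "r \<in> cLO S \<Longrightarrow> x \<in> B \<Longrightarrow> y \<in> B \<Longrightarrow> x \<noteq> y \<Longrightarrow> (x, y) \<in> r \<longleftrightarrow> (y, x) \<notin> r"
  using cLO_asym[of r x y] by (auto simp: cLO_iff total_on_def)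

lemma cLO_convex:
  assumes "r \<in> cLO S" "x \<in> B" "y \<in> B" "z \<in> B" "d x y < d x z"
  shows "(x, z) \<in> r \<longleftrightarrow> (y, z) \<in> r" "(z, x) \<in> r \<longleftrightarrow> (z, y) \<in> r"
proof -
  have "d y x < d y z" using isosceles[OF assms(2-5)] assms(5) B_dist_commute[of S x y] by simp
  then show "(x, z) \<in> r \<longleftrightarrow> (y, z) \<in> r" "(z, x) \<in> r \<longleftrightarrow> (z, y) \<in> r"
    using assms unfolding cLO_iff by meson+
qed

text \<open>
  In the presence of convexity, transitivity needs to be checked on equilateral triangles only:
  in any other triangle two vertices are closer to each other than to the third one.
\<close>

lemma cLO_I:
  assumes sub: "r \<subseteq> B \<times> B" and irr: "\<And>x. (x, x) \<notin> r"
    and tot: "\<And>x y. x \<in> B \<Longrightarrow> y \<in> B \<Longrightarrow> x \<noteq> y \<Longrightarrow> (x, y) \<in> r \<longleftrightarrow> (y, x) \<notin> r"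
    and conv: "\<And>x y z. x \<in> B \<Longrightarrow> y \<in> B \<Longrightarrow> z \<in> B \<Longrightarrow> d x y < d x z \<Longrightarrow> (x, z) \<in> r \<longleftrightarrow> (y, z) \<in> r"
    and tr: "\<And>x y z. x \<in> B \<Longrightarrow> y \<in> B \<Longrightarrow> z \<in> B \<Longrightarrow> d x y = d y z \<Longrightarrow> d x z = d y z \<Longrightarrow>
      (x, y) \<in> r \<Longrightarrow> (y, z) \<in> r \<Longrightarrow> (x, z) \<in> r"
  shows "r \<in> cLO S"
proof -
  have conv': "(z, x) \<in> r \<longleftrightarrow> (z, y) \<in> r"
    if B: "x \<in> B" "y \<in> B" "z \<in> B" and less: "d x y < d x z" for x y z
  proof -
    have "x \<noteq> z" using less d_nonneg[of x y] by (auto simp del: d_nonneg)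
    moreover have "y \<noteq> z" using less by auto
    ultimately show ?thesis using conv[OF B less] tot B by blast
  qed
  have trans: "(x, z) \<in> r" if xy: "(x, y) \<in> r" and yz: "(y, z) \<in> r" for x y z
  proof -
    have B: "x \<in> B" "y \<in> B" "z \<in> B" using xy yz sub by auto
    consider "d y x < d y z" | "d y z < d y x" | "d x y = d y z"
      using B_dist_commute[of S x y] by linarith
    then show ?thesis
    proof cases
      case 1
      then show ?thesis using conv[OF B(2,1,3)] yz by simp
    next
      case 2
      then show ?thesis using conv'[OF B(2,3,1)] xy by simp
    next
      case 3
      have le: "d x z \<le> d x y" using B_dist_ultrametric[OF pos B] 3 by simp
      show ?thesis
      proof (cases "d x z = d x y")
        case True
        then show ?thesis using tr[OF B] 3 xy yz by simp
      next
        case False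
        then have "(z, y) \<in> r" using conv[OF B(1,3,2)] le xy by simp
        moreover have "y \<noteq> z" using yz irr by blast
        ultimately show ?thesis using tot[OF B(2,3)] yz by blast
      qed
    qed
  qed
  show ?thesis
    unfolding cLO_iff
  proof (intro conjI ballI impI)
    show "trans r" using trans by (rule transI)
    show "irrefl r" using irr by (simp add: irrefl_def)
    show "total_on B r" using tot unfolding total_on_def by blast
  next
    fix x y z assume a: "x \<in> B" "y \<in> B" "z \<in> B" "d x y < d x z"
    show "(y, z) \<in> r" if "(x, z) \<in> r" using conv[OF a] that by simp
    show "(z, y) \<in> r" if "(z, x) \<in> r" using conv'[OF a] that by simp
  qed (rule sub)
qed

lemma lex_in_cLO: "lexo \<in> cLO S"
proof (rule cLO_I)
  show "lexo \<subseteq> B \<times> B" "(x, x) \<notin> lexo" for x by (auto simp: lex_iff)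
  show "(x, y) \<in> lexo \<longleftrightarrow> (y, x) \<notin> lexo" if "x \<in> B" "y \<in> B" "x \<noteq> y" for x y
    by (rule lex_total[OF that])
next
  fix x y z assume a: "x \<in> B" "y \<in> B" "z \<in> B" "d x y < d x z"
  have "x \<noteq> z" using a(4) d_nonneg[of x y] by (auto simp del: d_nonneg)
  then have "d x z \<in> S" using d_in_S a by blast
  then have "x (d x z) = y (d x z)" using B_dist_ge[OF a(1,2)] a(4) by (meson leD)
  moreover have "y \<noteq> z" using a(4) by auto
  ultimately show "(x, z) \<in> lexo \<longleftrightarrow> (y, z) \<in> lexo"
    using isosceles[OF a] a(1-3) \<open>x \<noteq> z\<close> by (simp add: lex_iff)
next
  fix x y z
  assume a: "x \<in> B" "z \<in> B" "d x y = d y z" "d x z = d y z" and "(x, y) \<in> lexo" "(y, z) \<in> lexo"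
  then have less: "x (d y z) < y (d y z)" "y (d y z) < z (d y z)" by (auto simp: lex_iff)
  then have "x \<noteq> z" by auto
  then show "(x, z) \<in> lexo" using less a by (simp add: lex_iff)
qed

lemma cLO_basic_iff:
  "q \<in> cLO_basic S F r \<longleftrightarrow> q \<in> cLO S \<and> (\<forall>x \<in> F. \<forall>y \<in> F. (x, y) \<in> q \<longleftrightarrow> (x, y) \<in> r)"
  unfolding cLO_basic_def by blast

lemma openin_cLO_iff:
  "openin (cLO_topology S) U \<longleftrightarrow> U \<subseteq> cLO S \<and>
     (\<forall>r \<in> U. \<exists>F. finite F \<and> F \<subseteq> B \<and> cLO_basic S F r \<subseteq> U)"
proof
  let ?\<B> = "{cLO_basic S F r | F r. finite F \<and> F \<subseteq> B \<and> r \<in> cLO S}"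
  assume o: "openin (cLO_topology S) U"
  then have "generate_topology_on ?\<B> U"
    unfolding cLO_topology_def by (rule openin_topology_generated_by)
  then have "\<forall>r \<in> U. \<exists>F. finite F \<and> F \<subseteq> B \<and> cLO_basic S F r \<subseteq> U"
  proof (induction rule: generate_topology_on.induct)
    case (Int a b)
    show ?case
    proof
      fix r assume r: "r \<in> a \<inter> b"
      obtain F1 where F1: "finite F1" "F1 \<subseteq> B" "cLO_basic S F1 r \<subseteq> a" using Int.IH(1) r by blast
      obtain F2 where F2: "finite F2" "F2 \<subseteq> B" "cLO_basic S F2 r \<subseteq> b" using Int.IH(2) r by blast
      have "cLO_basic S (F1 \<union> F2) r \<subseteq> cLO_basic S F1 r \<inter> cLO_basic S F2 r"
        by (auto simp: cLO_basic_iff)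
      then show "\<exists>F. finite F \<and> F \<subseteq> B \<and> cLO_basic S F r \<subseteq> a \<inter> b"
        using F1 F2 by (intro exI[of _ "F1 \<union> F2"]) blast
    qed
  next
    case (UN K)
    show ?case
    proof
      fix r assume "r \<in> \<Union>K"
      then obtain k where k: "k \<in> K" "r \<in> k" by blast
      then obtain F where "finite F" "F \<subseteq> B" "cLO_basic S F r \<subseteq> k" using UN.IH[OF k(1)] by blast
      then show "\<exists>F. finite F \<and> F \<subseteq> B \<and> cLO_basic S F r \<subseteq> \<Union>K" using k(1) by blast
    qed
  next
    case (Basis s)
    then obtain F r0 where F: "s = cLO_basic S F r0" "finite F" "F \<subseteq> B" by blast
    have "cLO_basic S F r \<subseteq> s" if "r \<in> s" for r using that F(1) by (simp add: cLO_basic_iff subset_iff)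
    then show ?case using F by blast
  qed simp
  then show "U \<subseteq> cLO S \<and> (\<forall>r \<in> U. \<exists>F. finite F \<and> F \<subseteq> B \<and> cLO_basic S F r \<subseteq> U)"
    using openin_subset[OF o] by simp
next
  assume U: "U \<subseteq> cLO S \<and> (\<forall>r \<in> U. \<exists>F. finite F \<and> F \<subseteq> B \<and> cLO_basic S F r \<subseteq> U)"
  then obtain F where F: "\<And>r. r \<in> U \<Longrightarrow> finite (F r) \<and> F r \<subseteq> B \<and> cLO_basic S (F r) r \<subseteq> U" by metis
  have "openin (cLO_topology S) (cLO_basic S (F r) r)" if "r \<in> U" for r
    unfolding cLO_topology_def using F that U by (intro topology_generated_by_Basis) blast
  then have "openin (cLO_topology S) (\<Union>r\<in>U. cLO_basic S (F r) r)" by auto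
  moreover have "(\<Union>r\<in>U. cLO_basic S (F r) r) = U"
    using F U by (auto simp: cLO_basic_iff)
  ultimately show "openin (cLO_topology S) U" by simp
qed

lemma openin_cLO_basic: "finite F \<Longrightarrow> F \<subseteq> B \<Longrightarrow> openin (cLO_topology S) (cLO_basic S F r)"
  unfolding openin_cLO_iff by (auto simp: cLO_basic_iff intro!: exI[of _ F])

lemma Hausdorff_cLO: "Hausdorff_space (cLO_topology S)"
  unfolding Hausdorff_space_def
proof (intro allI impI, elim conjE)
  fix r q assume rq: "r \<in> topspace (cLO_topology S)" "q \<in> topspace (cLO_topology S)" "r \<noteq> q"
  then obtain x y where xy: "x \<in> B" "y \<in> B" "(x, y) \<in> r \<longleftrightarrow> (x, y) \<notin> q"
    using cLO_subset[of r] cLO_subset[of q] by auto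
  show "\<exists>U V. openin (cLO_topology S) U \<and> openin (cLO_topology S) V \<and> r \<in> U \<and> q \<in> V \<and> disjnt U V"
    using rq xy openin_cLO_basic[of "{x, y}"]
    by (intro exI[of _ "cLO_basic S {x, y} r"] exI[of _ "cLO_basic S {x, y} q"])
      (auto simp: cLO_basic_iff disjnt_iff)
qed

text \<open>
  Together with a function that violates \<open>Q\<close>, all functions that agree with it on \<open>J\<close> violate \<open>Q\<close>, and
  they form an open set.
\<close>

lemma closedin_finite_coordinates:
  assumes "finite J" "J \<subseteq> I"
    and "\<And>\<xi> \<xi>'. \<xi> \<in> I \<rightarrow>\<^sub>E UNIV \<Longrightarrow> \<xi>' \<in> I \<rightarrow>\<^sub>E UNIV \<Longrightarrow> (\<And>i. i \<in> J \<Longrightarrow> \<xi> i = \<xi>' i) \<Longrightarrow> Q \<xi> \<Longrightarrow> Q \<xi>'"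
  shows "closedin (product_topology (\<lambda>_. discrete_topology UNIV) I) {\<xi> \<in> I \<rightarrow>\<^sub>E UNIV. Q \<xi>}"
proof -
  have "openin (product_topology (\<lambda>_. discrete_topology UNIV) I) ((I \<rightarrow>\<^sub>E UNIV) - {\<xi> \<in> I \<rightarrow>\<^sub>E UNIV. Q \<xi>})"
    unfolding openin_product_topology_alt
  proof
    fix \<xi> assume \<xi>: "\<xi> \<in> (I \<rightarrow>\<^sub>E UNIV) - {\<xi> \<in> I \<rightarrow>\<^sub>E UNIV. Q \<xi>}"
    let ?N = "\<lambda>i. if i \<in> J then {\<xi> i} else UNIV"
    have "finite {i \<in> I. ?N i \<noteq> UNIV}" by (rule finite_subset[OF _ assms(1)]) auto
    moreover have "\<xi> \<in> Pi\<^sub>E I ?N" using \<xi> by (auto simp: PiE_iff)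
    moreover have "Pi\<^sub>E I ?N \<subseteq> (I \<rightarrow>\<^sub>E UNIV) - {\<xi> \<in> I \<rightarrow>\<^sub>E UNIV. Q \<xi>}"
    proof
      fix \<xi>' assume \<xi>': "\<xi>' \<in> Pi\<^sub>E I ?N"
      then have *: "\<xi>' \<in> I \<rightarrow>\<^sub>E UNIV" by (auto simp: PiE_iff)
      have "\<xi>' i = \<xi> i" if "i \<in> J" for i
        using \<xi>' that assms(2) by (auto simp: PiE_iff dest!: bspec[of I _ i])
      then have "\<not> Q \<xi>'" using assms(3)[of \<xi>' \<xi>] \<xi> * by auto
      then show "\<xi>' \<in> (I \<rightarrow>\<^sub>E UNIV) - {\<xi> \<in> I \<rightarrow>\<^sub>E UNIV. Q \<xi>}" using * by auto
    qed
    ultimately show "\<exists>U. finite {i \<in> I. U i \<noteq> topspace (discrete_topology UNIV)} \<and>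
        (\<forall>i\<in>I. openin (discrete_topology UNIV) (U i)) \<and> \<xi> \<in> Pi\<^sub>E I U \<and>
        Pi\<^sub>E I U \<subseteq> (I \<rightarrow>\<^sub>E UNIV) - {\<xi> \<in> I \<rightarrow>\<^sub>E UNIV. Q \<xi>}"
      by (intro exI[of _ ?N]) simp
  qed
  then show ?thesis unfolding closedin_def by auto
qed

text \<open>
  Convex orderings are the relations satisfying a family of conditions \<open>Q x y z\<close> on finitely many
  pairs each.  Their indicator functions thus form a closed subset of a product of finite discrete
  spaces, and the convex orderings are a continuous image of this compact set.
\<close>

lemma compact_cLO: "compact_space (cLO_topology S)"
proof -
  let ?I = "B \<times> B"
  let ?P = "product_topology (\<lambda>_. discrete_topology (UNIV :: bool set)) ?I"
  define rel where "rel \<xi> = {p \<in> ?I. \<xi> p}" for \<xi> :: "point \<times> point \<Rightarrow> bool"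
  define E where "E = {\<xi> \<in> ?I \<rightarrow>\<^sub>E UNIV. rel \<xi> \<in> cLO S}"
  define Q where "Q x y z r \<longleftrightarrow> (x, x) \<notin> r \<and> ((x, y) \<in> r \<and> (y, z) \<in> r \<longrightarrow> (x, z) \<in> r) \<and>
      (x \<noteq> y \<longrightarrow> (x, y) \<in> r \<or> (y, x) \<in> r) \<and>
      (d x y < d x z \<longrightarrow> ((x, z) \<in> r \<longrightarrow> (y, z) \<in> r) \<and> ((z, x) \<in> r \<longrightarrow> (z, y) \<in> r))" for x y z r
  have Q: "r \<in> cLO S \<longleftrightarrow> (\<forall>x \<in> B. \<forall>y \<in> B. \<forall>z \<in> B. Q x y z r)" if r: "r \<subseteq> ?I" for r
  proof (intro iffI ballI)
    fix x y z assume r: "r \<in> cLO S" and B: "x \<in> B" "y \<in> B" "z \<in> B"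
    have "(x, y) \<in> r \<and> (y, z) \<in> r \<longrightarrow> (x, z) \<in> r"
      using r unfolding cLO_iff by (blast dest: transD)
    then show "Q x y z r"
      using cLO_irrefl[OF r, of x] cLO_total[OF r B(1,2)] cLO_convex[OF r B] unfolding Q_def by simp
  next
    assume *: "\<forall>x \<in> B. \<forall>y \<in> B. \<forall>z \<in> B. Q x y z r"
    have irr: "(x, x) \<notin> r" for x
    proof
      assume "(x, x) \<in> r"
      then have "Q x x x r" using * r by blast
      then show False using \<open>(x, x) \<in> r\<close> by (simp add: Q_def)
    qed
    have tr: "(x, z) \<in> r" if "(x, y) \<in> r" "(y, z) \<in> r" for x y z
    proof -
      have "Q x y z r" using * r that by blast
      then show ?thesis using that by (simp add: Q_def)
    qed
    have tot: "(x, y) \<in> r \<or> (y, x) \<in> r" if "x \<in> B" "y \<in> B" "x \<noteq> y" for x y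
    proof -
      have "Q x y y r" using * that by blast
      then show ?thesis using that by (simp add: Q_def)
    qed
    show "r \<in> cLO S"
      unfolding cLO_iff
    proof (intro conjI ballI impI)
      show "irrefl r" using irr by (simp add: irrefl_def)
      show "trans r" using tr by (rule transI)
      show "total_on B r" using tot by (simp add: total_on_def)
      show "r \<subseteq> ?I" by (rule r)
    next
      fix x y z assume a: "x \<in> B" "y \<in> B" "z \<in> B" "d x y < d x z"
      then have q: "Q x y z r" using * by blast
      show "(y, z) \<in> r" if "(x, z) \<in> r" using q that a by (simp add: Q_def)
      show "(z, y) \<in> r" if "(z, x) \<in> r" using q that a by (simp add: Q_def)
    qed
  qed
  have "E = {\<xi> \<in> ?I \<rightarrow>\<^sub>E UNIV. \<forall>x \<in> B. \<forall>y \<in> B. \<forall>z \<in> B. Q x y z (rel \<xi>)}"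
    unfolding E_def using Q[of "rel _"] by (simp add: rel_def)
  also have "\<dots> = (\<Inter>x \<in> B. \<Inter>y \<in> B. \<Inter>z \<in> B. {\<xi> \<in> ?I \<rightarrow>\<^sub>E UNIV. Q x y z (rel \<xi>)})"
    using B_nonempty by blast
  also have "closedin ?P \<dots>"
  proof (intro closedin_INT)
    fix x y z assume xyz: "x \<in> B" "y \<in> B" "z \<in> B"
    show "closedin ?P {\<xi> \<in> ?I \<rightarrow>\<^sub>E UNIV. Q x y z (rel \<xi>)}"
    proof (rule closedin_finite_coordinates[of "{x, y, z} \<times> {x, y, z}"])
      fix \<xi> \<xi>' :: "point \<times> point \<Rightarrow> bool"
      assume "\<And>i. i \<in> {x, y, z} \<times> {x, y, z} \<Longrightarrow> \<xi> i = \<xi>' i" "Q x y z (rel \<xi>)"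
      then show "Q x y z (rel \<xi>')" using xyz by (simp add: Q_def rel_def)
    qed (use xyz in auto)
  qed (use B_nonempty in auto)
  finally have clE: "closedin ?P E" .
  have "compact_space ?P" by (simp add: compact_space_product_topology compact_space_discrete_topology)
  then have "compactin ?P E" using clE closedin_compact_space by blast
  then have "compact_space (subtopology ?P E)" by (simp add: compact_space_subtopology)
  moreover have "continuous_map (subtopology ?P E) (cLO_topology S) rel"
    unfolding continuous_map_def
  proof (intro conjI allI impI)
    show "rel \<in> topspace (subtopology ?P E) \<rightarrow> topspace (cLO_topology S)" by (auto simp: E_def)
    fix U assume U: "openin (cLO_topology S) U"
    have "openin (subtopology ?P E) {\<xi> \<in> E. rel \<xi> \<in> U}"
    proof (subst openin_subopen, clarify)
      fix \<xi> assume \<xi>: "\<xi> \<in> E" "rel \<xi> \<in> U"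
      then obtain F where F: "finite F" "F \<subseteq> B" "cLO_basic S F (rel \<xi>) \<subseteq> U"
        using U unfolding openin_cLO_iff by meson
      let ?N = "E \<inter> (topspace ?P - {\<xi>' \<in> ?I \<rightarrow>\<^sub>E UNIV. \<not> (\<forall>p \<in> F \<times> F. \<xi>' p = \<xi> p)})"
      have "closedin ?P {\<xi>' \<in> ?I \<rightarrow>\<^sub>E UNIV. \<not> (\<forall>p \<in> F \<times> F. \<xi>' p = \<xi> p)}"
        by (rule closedin_finite_coordinates[of "F \<times> F"]) (use F in auto)
      then have "openin ?P (topspace ?P - {\<xi>' \<in> ?I \<rightarrow>\<^sub>E UNIV. \<not> (\<forall>p \<in> F \<times> F. \<xi>' p = \<xi> p)})"
        by blast
      then have "openin (subtopology ?P E)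
          ?N"
        by (rule openin_subtopology_Int2)
      moreover have "?N \<subseteq> {\<xi> \<in> E. rel \<xi> \<in> U}"
        using F by (auto simp: E_def cLO_basic_iff rel_def intro!: subsetD[OF F(3)])
      ultimately show "\<exists>T. openin (subtopology ?P E) T \<and> \<xi> \<in> T \<and> T \<subseteq> {\<xi> \<in> E. rel \<xi> \<in> U}"
        using \<xi> by (intro exI[of _ ?N]) (simp add: E_def)
    qed
    moreover have "topspace (subtopology ?P E) = E" by (auto simp: E_def)
    ultimately show "openin (subtopology ?P E) {\<xi> \<in> topspace (subtopology ?P E). rel \<xi> \<in> U}" by simp
  qed
  ultimately have "compactin (cLO_topology S) (rel ` topspace (subtopology ?P E))"
    using image_compactin compact_space_def by blast
  moreover have "rel ` topspace (subtopology ?P E) = cLO S"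
  proof
    show "cLO S \<subseteq> rel ` topspace (subtopology ?P E)"
    proof
      fix r assume r: "r \<in> cLO S"
      then have "rel (\<lambda>p\<in>?I. p \<in> r) = r" using cLO_subset[OF r] by (auto simp: rel_def)
      then show "r \<in> rel ` topspace (subtopology ?P E)"
        using r by (intro image_eqI[of _ _ "\<lambda>p\<in>?I. p \<in> r"]) (auto simp: E_def)
    qed
  qed (auto simp: E_def)
  ultimately show ?thesis by (simp add: compact_space_def)
qed

abbreviation "act \<equiv> cLO_action S"

lemma act_iff:
  assumes "r \<in> cLO S"
  shows "(x, y) \<in> act g r \<longleftrightarrow> x \<in> B \<and> y \<in> B \<and> ((inv\<^bsub>G\<^esub> g) x, (inv\<^bsub>G\<^esub> g) y) \<in> r"
  using assms by (simp add: cLO_action_def)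

lemma act_image_iff:
  assumes "r \<in> cLO S" "g \<in> carrier G" "x \<in> B" "y \<in> B"
  shows "(g x, g y) \<in> act g r \<longleftrightarrow> (x, y) \<in> r"
  using assms by (simp add: act_iff inv_apply G_in)

lemma act_in:
  assumes r: "r \<in> cLO S" and g: "g \<in> carrier G"
  shows "act g r \<in> cLO S"
proof -
  let ?i = "inv\<^bsub>G\<^esub> g"
  have i: "?i \<in> carrier G" using g by simp
  note C = r[unfolded cLO_iff]
  note iso = G_isometry[OF i] and inB = G_in[OF i]
  show ?thesis
    unfolding cLO_iff
  proof (intro conjI ballI impI)
    show "act g r \<subseteq> B \<times> B" using act_iff[OF r] by auto
    show "irrefl (act g r)" using C act_iff[OF r] by (auto simp: irrefl_def)
    show "trans (act g r)" unfolding trans_def act_iff[OF r] using C[unfolded trans_def] by meson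
    show "total_on B (act g r)"
      unfolding total_on_def act_iff[OF r] using C[unfolded total_on_def] inB G_inj[OF i] by meson
  next
    fix x y z assume "x \<in> B" "y \<in> B" "z \<in> B" "d x y < d x z" "(x, z) \<in> act g r"
    then show "(y, z) \<in> act g r"
      using cLO_convex(1)[OF r, of "?i x" "?i y" "?i z"] iso inB by (simp add: act_iff[OF r])
  next
    fix x y z assume "x \<in> B" "y \<in> B" "z \<in> B" "d x y < d x z" "(z, x) \<in> act g r"
    then show "(z, y) \<in> act g r"
      using cLO_convex(2)[OF r, of "?i x" "?i y" "?i z"] iso inB by (simp add: act_iff[OF r])
  qed
qed

lemma act_mult:
  assumes r: "r \<in> cLO S" and g: "g \<in> carrier G" "h \<in> carrier G"
  shows "act (g \<otimes>\<^bsub>G\<^esub> h) r = act g (act h r)"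
proof -
  have inv: "(inv\<^bsub>G\<^esub> (g \<otimes>\<^bsub>G\<^esub> h)) x = (inv\<^bsub>G\<^esub> h) ((inv\<^bsub>G\<^esub> g) x)" if "x \<in> B" for x
    using g that by (simp add: G.inv_mult_group mult_apply)
  have "(x, y) \<in> act (g \<otimes>\<^bsub>G\<^esub> h) r \<longleftrightarrow> (x, y) \<in> act g (act h r)" for x y
  proof (cases "x \<in> B \<and> y \<in> B")
    case True
    then show ?thesis
      using inv g(1) G_in[of "inv\<^bsub>G\<^esub> g"] by (simp add: act_iff[OF r] act_iff[OF act_in[OF r g(2)]])
  next
    case False
    then show ?thesis unfolding act_iff[OF r] act_iff[OF act_in[OF r g(2)]] by blast
  qed
  then show ?thesis by auto
qed

lemma act_one: "r \<in> cLO S \<Longrightarrow> act \<one>\<^bsub>G\<^esub> r = r"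
  using cLO_subset[of r] by (auto simp: act_iff one_apply)

lemma group_action_cLO: "group_action G (cLO S) act"
proof -
  have bij: "act g \<in> Bij (cLO S)" if g: "g \<in> carrier G" for g
  proof -
    have "act (inv\<^bsub>G\<^esub> g) (act g r) = r" "act g (act (inv\<^bsub>G\<^esub> g) r) = r" if "r \<in> cLO S" for r
      using act_mult[OF that, of "inv\<^bsub>G\<^esub> g" g] act_mult[OF that, of g "inv\<^bsub>G\<^esub> g"] act_one[OF that] g
      by auto
    then have "bij_betw (act g) (cLO S) (cLO S)"
      using g act_in by (intro bij_betw_byWitness[where f'="act (inv\<^bsub>G\<^esub> g)"]) auto
    then show ?thesis by (simp add: Bij_def cLO_action_def)
  qed
  have "act (g \<otimes>\<^bsub>G\<^esub> h) = act g \<otimes>\<^bsub>BijGroup (cLO S)\<^esub> act h"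
    if g: "g \<in> carrier G" "h \<in> carrier G" for g h
  proof -
    have "act (g \<otimes>\<^bsub>G\<^esub> h) = compose (cLO S) (act g) (act h)"
    proof (rule extensionalityI[of _ "cLO S"])
      show "act (g \<otimes>\<^bsub>G\<^esub> h) \<in> extensional (cLO S)" by (simp add: cLO_action_def)
    qed (use g act_mult in \<open>auto simp: compose_def\<close>)
    then show ?thesis using bij g by (simp add: BijGroup_def)
  qed
  then show ?thesis
    using bij group_G group_BijGroup
    by (auto simp: group_action_def group_hom_def group_hom_axioms_def hom_def BijGroup_def)
qed

lemma act_basic:
  assumes r: "r \<in> cLO S" and q: "q \<in> cLO S" and g: "g \<in> carrier G" and h: "h \<in> carrier G"
    and F: "F \<subseteq> B" and hg: "\<And>x. x \<in> F \<Longrightarrow> (inv\<^bsub>G\<^esub> h) x = (inv\<^bsub>G\<^esub> g) x"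
    and rq: "q \<in> cLO_basic S ((inv\<^bsub>G\<^esub> g) ` F) r"
  shows "act h q \<in> cLO_basic S F (act g r)"
  using assms act_in by (auto simp: cLO_basic_iff act_iff)

lemma flow_cLO: "flow G (iso_topology S) (cLO_topology S) act"
  unfolding flow_def
proof (intro conjI)
  show "topspace (cLO_topology S) \<noteq> {}" using lex_in_cLO by auto
  show "continuous_map (prod_topology (iso_topology S) (cLO_topology S)) (cLO_topology S) (\<lambda>(g, r). act g r)"
  proof (rule continuous_map_from_prodI)
    fix g r assume "g \<in> topspace (iso_topology S)" "r \<in> topspace (cLO_topology S)"
    then show "(case (g, r) of (g, r) \<Rightarrow> act g r) \<in> topspace (cLO_topology S)" by (simp add: act_in)
  next
    fix g r W assume "g \<in> topspace (iso_topology S)" "r \<in> topspace (cLO_topology S)"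
      and W: "openin (cLO_topology S) W" "(case (g, r) of (g, r) \<Rightarrow> act g r) \<in> W"
    then have gr: "g \<in> carrier G" "r \<in> cLO S" by auto
    obtain F where F: "finite F" "F \<subseteq> B" "cLO_basic S F (act g r) \<subseteq> W"
      using W unfolding openin_cLO_iff by auto
    let ?F = "(inv\<^bsub>G\<^esub> g) ` F"
    have F': "?F \<subseteq> B" using F gr G_in[of "inv\<^bsub>G\<^esub> g"] by auto
    have "act h q \<in> W" if hq: "h \<in> carrier G" "\<forall>x \<in> ?F. h x = g x" "q \<in> cLO_basic S ?F r" for h q
    proof -
      have "(inv\<^bsub>G\<^esub> h) x = (inv\<^bsub>G\<^esub> g) x" if "x \<in> F" for x
      proof -
        have "h ((inv\<^bsub>G\<^esub> g) x) = x" using that F hq gr inv_apply(2)[of g x] by auto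
        then show ?thesis using inv_apply(1)[OF hq(1), of "(inv\<^bsub>G\<^esub> g) x"] that F' by auto
      qed
      then show ?thesis using act_basic[of r q g h F] hq gr F by (auto simp: cLO_basic_iff)
    qed
    then show "\<exists>U V. openin (iso_topology S) U \<and> openin (cLO_topology S) V \<and> g \<in> U \<and> r \<in> V \<and>
        (\<forall>u\<in>U. \<forall>v\<in>V. (case (u, v) of (g, r) \<Rightarrow> act g r) \<in> W)"
      using openin_iso_nbhd[of ?F g] openin_cLO_basic[of ?F r] F F' gr
      by (intro exI[of _ "{h \<in> carrier G. \<forall>x \<in> ?F. h x = g x}"] exI[of _ "cLO_basic S ?F r"])
        (auto simp: cLO_basic_iff)
  qed
qed (simp_all add: topological_group_iso compact_cLO Hausdorff_cLO group_action_cLO)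

end

section \<open>Homogeneity of the lexicographic ordering\<close>

lemma finite_sets_separated:
  fixes L R :: "rat set"
  assumes "finite L" "finite R" "\<And>l r. l \<in> L \<Longrightarrow> r \<in> R \<Longrightarrow> l < r"
  shows "\<exists>v. (\<forall>l \<in> L. l < v) \<and> (\<forall>r \<in> R. v < r)"
proof (cases "L = {} \<or> R = {}")
  case True
  obtain a where "\<forall>l \<in> L. l < a" using assms(1) by (metis Max_ge gt_ex le_less_trans)
  moreover obtain b where "\<forall>r \<in> R. b < r" using assms(2) by (metis Min_le lt_ex less_le_trans)
  ultimately show ?thesis using True by auto
next
  case False
  then have "Max L < Min R" using assms by simp
  then obtain v where "Max L < v" "v < Min R" using dense by blast
  then show ?thesis using assms False by (intro exI[of _ v]) simp
qed

context distance_set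
begin

definition "moves = {mv t c f | t c f. t \<in> S \<and> c \<in> B \<and> f \<in> rat_auts}"

definition "move_group = generate G moves"

lemma moves_subset: "moves \<subseteq> carrier G"
  using move_in_G rat_auts_inv(4) by (auto simp: moves_def)

lemma move_group_subset: "move_group \<subseteq> carrier G"
  using G.generate_incl[OF moves_subset] by (simp add: move_group_def)

lemma move_group_lex_iff:
  assumes "h \<in> move_group" "x \<in> B" "y \<in> B"
  shows "(h x, h y) \<in> lexo \<longleftrightarrow> (x, y) \<in> lexo"
proof -
  have *: "(k x, k y) \<in> lexo \<longleftrightarrow> (x, y) \<in> lexo" if k: "k \<in> moves" and xy: "x \<in> B" "y \<in> B" for k x y
  proof -
    have pres: "(k x, k y) \<in> lexo" if "x \<in> B" "y \<in> B" "(x, y) \<in> lexo" for x y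
      using that k move_lex by (auto simp: moves_def)
    have kG: "k \<in> carrier G" using k moves_subset by auto
    show ?thesis
    proof (cases "x = y")
      case True
      then show ?thesis using cLO_irrefl[OF lex_in_cLO] by simp
    next
      case False
      then have "k x \<noteq> k y" using G_inj[OF kG xy] by simp
      then show ?thesis
        using pres[OF xy] pres[OF xy(2,1)] lex_total[OF xy False] lex_total[OF G_in[OF kG xy(1)] G_in[OF kG xy(2)]]
        by blast
    qed
  qed
  have "\<forall>x \<in> B. \<forall>y \<in> B. (h x, h y) \<in> lexo \<longleftrightarrow> (x, y) \<in> lexo"
    using assms(1) unfolding move_group_def
  proof (induction rule: generate.induct)
    case (inv h)
    then have h: "h \<in> carrier G" "inv\<^bsub>G\<^esub> h \<in> carrier G" using moves_subset by auto
    show ?case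
      using *[OF inv] inv_apply(2)[OF h(1)] G_in[OF h(2)] by metis
  next
    case (eng h1 h2)
    then have "h1 \<in> carrier G" "h2 \<in> carrier G" using move_group_subset by (auto simp: move_group_def)
    then show ?case using eng.IH by (simp add: mult_apply G_in)
  qed (use * one_apply in auto)
  then show ?thesis using assms by blast
qed

text \<open>
  Let \<open>t = d w z\<close>.  No point of \<open>D\<close> is closer to \<open>w\<close> than \<open>t\<close>, as it would have different distances
  to \<open>w\<close> and \<open>z\<close>.  So \<open>w t\<close> and \<open>z t\<close> both differ from the coordinates \<open>b t\<close> of the points \<open>b\<close> in the
  ball of \<open>w\<close>, and lie on the same side of each of them.  A single move about that ball therefore
  carries \<open>w t\<close> to \<open>z t\<close> and fixes \<open>D\<close>, after which \<open>w\<close> and \<open>z\<close> differ in one coordinate less.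
\<close>

lemma move_group_moves_point:
  assumes "finite D" "D \<subseteq> B" "w \<in> B" "z \<in> B"
    and "\<And>b. b \<in> D \<Longrightarrow> d w b = d z b" "\<And>b. b \<in> D \<Longrightarrow> (w, b) \<in> lexo \<longleftrightarrow> (z, b) \<in> lexo"
  shows "\<exists>h \<in> move_group. (\<forall>b \<in> D. h b = b) \<and> h w = z"
  using assms(3-)
proof (induction "card {s \<in> S. w s \<noteq> z s}" arbitrary: w rule: less_induct)
  case less
  show ?case
  proof (cases "w = z")
    case True
    then show ?thesis
      using assms(2) less.prems by (intro bexI[of _ "\<one>\<^bsub>G\<^esub>"]) (auto simp: one_apply move_group_def generate.one)
  next
    case False
    define t where "t = d w z"
    have t: "t \<in> S" "w t \<noteq> z t"
      using B_dist_in[OF less.prems(1,2) False] by (auto simp: t_def)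
    have far: "t \<le> d w b" if "b \<in> D" for b
    proof (rule ccontr)
      assume "\<not> t \<le> d w b"
      then have "d b z = d w z" using isosceles[of w b z] that assms(2) less.prems by (auto simp: t_def)
      then show False using less.prems(3)[OF that] \<open>\<not> t \<le> d w b\<close> by (simp add: t_def B_dist_commute)
    qed
    define D\<^sub>t where "D\<^sub>t = {b \<in> D. d b w \<le> t}"
    have Dt: "b \<in> B" "d w b = t" "d z b = t" "w t \<noteq> b t" "z t \<noteq> b t" "w \<noteq> b" "z \<noteq> b" if "b \<in> D\<^sub>t" for b
    proof -
      have b: "b \<in> D" using that by (simp add: D\<^sub>t_def)
      show bB: "b \<in> B" using b assms(2) by auto
      show wb: "d w b = t" using that far[OF b] by (simp add: D\<^sub>t_def B_dist_commute)
      then show zb: "d z b = t" using less.prems(3)[OF b] by simp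
      have "0 < t" using S_pos t by auto
      then show "w \<noteq> b" "z \<noteq> b" using wb zb by auto
      then show "w t \<noteq> b t" "z t \<noteq> b t"
        using B_dist_in(2)[of w S b] B_dist_in(2)[of z S b] wb zb bB less.prems by auto
    qed
    have side: "w t < b t \<longleftrightarrow> z t < b t" if "b \<in> D\<^sub>t" for b
      using less.prems(4)[of b] Dt[OF that] that less.prems(1,2) by (auto simp: lex_iff D\<^sub>t_def)
    define P where "P = (\<lambda>b. b t) ` D\<^sub>t"
    have "w t \<notin> P" using Dt by (auto simp: P_def)
    have side': "p < w t \<longleftrightarrow> p < z t" "w t < p \<longleftrightarrow> z t < p" if "p \<in> P" for p
    proof -
      obtain b where b: "b \<in> D\<^sub>t" "p = b t" using \<open>p \<in> P\<close> by (auto simp: P_def)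
      show "p < w t \<longleftrightarrow> p < z t" "w t < p \<longleftrightarrow> z t < p"
        using side[OF b(1)] Dt(4,5)[OF b(1)] b(2) by (cases "w t < b t"; simp add: less_le not_less)+
    qed
    have "strict_mono_on (insert (w t) P) (id(w t := z t))"
      using side' \<open>w t \<notin> P\<close> by (auto simp: strict_mono_on_def)
    moreover have "finite (insert (w t) P)" using assms(1) by (simp add: P_def D\<^sub>t_def)
    ultimately obtain f where f: "f \<in> rat_auts" "\<forall>x \<in> insert (w t) P. f x = (id(w t := z t)) x"
      using strict_mono_on_rat_extends by blast
    then have fw: "f (w t) = z t" and fP: "\<And>p. p \<in> P \<Longrightarrow> f p = p"
      using \<open>w t \<notin> P\<close> by (auto split: if_splits)
    define k where "k = mv t w f"
    have k: "k \<in> move_group" using t less.prems f unfolding k_def move_group_def moves_def by (intro generate.incl) auto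
    then have kG: "k \<in> carrier G" using move_group_subset by auto
    have kb: "k b = b" if "b \<in> D" for b
      using that fP assms(2) by (auto simp: k_def move_apply P_def D\<^sub>t_def subset_iff)
    have kw: "k w = w(t := z t)"
      using less.prems S_pos[OF t(1)] fw by (simp add: k_def move_apply)
    have "{s \<in> S. (k w) s \<noteq> z s} \<subset> {s \<in> S. w s \<noteq> z s}" using t kw by auto
    then have "card {s \<in> S. (k w) s \<noteq> z s} < card {s \<in> S. w s \<noteq> z s}"
      using finite_B_diff[of w S z] less.prems by (intro psubset_card_mono)
    moreover have "d (k w) b = d z b" "(k w, b) \<in> lexo \<longleftrightarrow> (z, b) \<in> lexo" if "b \<in> D" for b
      using G_isometry[OF kG, of w b] move_group_lex_iff[OF k, of w b] less.prems kb[OF that] that assms(2) by auto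
    ultimately obtain h where h: "h \<in> move_group" "\<forall>b \<in> D. h b = b" "h (k w) = z"
      using less.hyps[of "k w"] G_in[OF kG] less.prems by blast
    have "h \<otimes>\<^bsub>G\<^esub> k \<in> move_group" using h k by (simp add: move_group_def generate.eng)
    then show ?thesis
      using h kb kG move_group_subset less.prems assms(2)
      by (intro bexI[of _ "h \<otimes>\<^bsub>G\<^esub> k"]) (auto simp: mult_apply subset_iff)
  qed
qed

text \<open>
  Points of \<open>D\<close> are put into place one by one, each without disturbing the previous ones.
\<close>

lemma move_group_dense_in_lex_automorphisms:
  assumes "k \<in> carrier G" "finite D" "D \<subseteq> B"
    and "\<And>x y. x \<in> D \<Longrightarrow> y \<in> D \<Longrightarrow> (k x, k y) \<in> lexo \<longleftrightarrow> (x, y) \<in> lexo"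
  shows "\<exists>h \<in> move_group. \<forall>x \<in> D. h x = k x"
  using assms(2-)
proof (induction D rule: finite_induct)
  case empty
  then show ?case by (auto simp: move_group_def intro: generate.one)
next
  case (insert w D)
  then obtain h where h: "h \<in> move_group" "\<forall>x \<in> D. h x = k x" by auto
  then have hG: "h \<in> carrier G" using move_group_subset by auto
  have DB: "D \<subseteq> B" "w \<in> B" using insert by auto
  have same: "d (h w) b = d (k w) b \<and> ((h w, b) \<in> lexo \<longleftrightarrow> (k w, b) \<in> lexo)" if "b \<in> k ` D" for b
  proof -
    obtain x where x: "x \<in> D" "b = k x" using \<open>b \<in> k ` D\<close> by auto
    then have x: "x \<in> D" "x \<in> B" "b = k x" "b = h x" using h(2) DB(1) by auto
    have "d (h w) b = d w x" using G_isometry[OF hG DB(2) x(2)] x(4) by simp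
    moreover have "d (k w) b = d w x" using G_isometry[OF assms(1) DB(2) x(2)] x(3) by simp
    moreover have "(h w, b) \<in> lexo \<longleftrightarrow> (w, x) \<in> lexo" using move_group_lex_iff[OF h(1) DB(2) x(2)] x(4) by simp
    moreover have "(k w, b) \<in> lexo \<longleftrightarrow> (w, x) \<in> lexo" using insert.prems(2)[of w x] x by simp
    ultimately show ?thesis by simp
  qed
  have "\<exists>g \<in> move_group. (\<forall>b \<in> k ` D. g b = b) \<and> g (h w) = k w"
  proof (rule move_group_moves_point)
    show "finite (k ` D)" using insert.hyps by simp
    show "k ` D \<subseteq> B" using DB(1) G_in[OF assms(1)] by auto
    show "h w \<in> B" "k w \<in> B" using G_in DB(2) assms(1) hG by auto
  qed (use same in auto)
  then obtain g where g: "g \<in> move_group" "\<forall>b \<in> k ` D. g b = b" "g (h w) = k w" by blast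
  have "g \<otimes>\<^bsub>G\<^esub> h \<in> move_group" using g h by (simp add: move_group_def generate.eng)
  moreover have "(g \<otimes>\<^bsub>G\<^esub> h) x = k x" if "x \<in> insert w D" for x
    using that g h hG move_group_subset DB by (auto simp: mult_apply subset_iff)
  ultimately show ?case by blast
qed

lemma move_group_two_homogeneous:
  assumes "(x, y) \<in> lexo" "(x', y') \<in> lexo" "d x y = d x' y'"
  shows "\<exists>h \<in> move_group. h x = x' \<and> h y = y'"
proof -
  have B: "x \<in> B" "y \<in> B" "x' \<in> B" "y' \<in> B" using assms by (auto simp: lex_iff)
  obtain h where h: "h \<in> move_group" "h x = x'" using move_group_moves_point[of "{}" x x'] B by auto
  then have hG: "h \<in> carrier G" using move_group_subset by auto
  have xy: "d (h y) x' = d y' x'" "(h y, x') \<in> lexo \<longleftrightarrow> (y', x') \<in> lexo"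
    using G_isometry[OF hG B(2,1)] move_group_lex_iff[OF h(1) B(2,1)] h(2) assms B_dist_commute[of S]
      cLO_asym[OF lex_in_cLO] by auto
  then obtain g where g: "g \<in> move_group" "g x' = x'" "g (h y) = y'"
    using move_group_moves_point[of "{x'}" "h y" y'] B G_in[OF hG] by auto
  have "g \<otimes>\<^bsub>G\<^esub> h \<in> move_group" using g h by (simp add: move_group_def generate.eng)
  then show ?thesis using g h hG move_group_subset B
    by (intro bexI[of _ "g \<otimes>\<^bsub>G\<^esub> h"]) (auto simp: mult_apply subset_iff)
qed

text \<open>
  The points of \<open>F\<close> are added one by one.  Let \<open>s\<close> be the distance of the new point \<open>w\<close> to \<open>F\<close>,
  attained at \<open>a\<close>, and let \<open>N\<close> be the set of the points of \<open>F\<close> that are at distance \<open>s\<close> from \<open>w\<close>.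
  Convexity of \<open>q\<close> makes the coordinates \<open>g b s\<close>, for \<open>b \<in> N\<close> below \<open>w\<close>, smaller than those for
  \<open>b \<in> N\<close> above \<open>w\<close>, and changing the coordinate \<open>s\<close> of \<open>g w\<close> to a value \<open>v\<close> between them puts \<open>w\<close>
  in the right position with respect to \<open>N\<close>.  With respect to the points further away, \<open>w\<close> is in the
  same position as \<open>a\<close>, by convexity.
\<close>

lemma convex_order_realized_in_lex:
  assumes q: "q \<in> cLO S" and "finite F" "F \<subseteq> B"
  shows "\<exists>g \<in> carrier G. \<forall>x \<in> F. \<forall>y \<in> F. (g x, g y) \<in> lexo \<longleftrightarrow> (x, y) \<in> q"
  using assms(2,3)
proof (induction F rule: finite_induct)
  case empty
  then show ?case by auto
next
  case (insert w F)
  then obtain g where g: "g \<in> carrier G" "\<And>x y. x \<in> F \<Longrightarrow> y \<in> F \<Longrightarrow> (g x, g y) \<in> lexo \<longleftrightarrow> (x, y) \<in> q"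
    by auto
  have FB: "F \<subseteq> B" "w \<in> B" "finite F" using insert by auto
  have suff: ?case if k: "k \<in> carrier G" "\<And>x. x \<in> F \<Longrightarrow> k x = g x"
    and kw: "\<And>x. x \<in> F \<Longrightarrow> (g x, k w) \<in> lexo \<longleftrightarrow> (x, w) \<in> q" for k
  proof (intro bexI[OF _ k(1)] ballI)
    have kw': "(k w, g x) \<in> lexo \<longleftrightarrow> (w, x) \<in> q" if "x \<in> F" for x
    proof -
      have x: "x \<in> B" "x \<noteq> w" using that FB insert by auto
      then have "k w \<noteq> g x" using G_inj[OF k(1), of w x] k(2)[OF that] FB by auto
      then show ?thesis
        using kw[OF that] lex_total[of "k w" "g x"] cLO_total[OF q, of w x] x FB G_in k(1) g(1) by auto
    qed
    fix x y assume "x \<in> insert w F" "y \<in> insert w F"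
    then show "(k x, k y) \<in> lexo \<longleftrightarrow> (x, y) \<in> q"
      using g(2) k(2) kw kw' cLO_irrefl[OF q] cLO_irrefl[OF lex_in_cLO] by auto
  qed
  show ?case
  proof (cases "F = {}")
    case True
    then show ?thesis using suff[OF g(1)] by auto
  next
    case False
    define s where "s = Min (d w ` F)"
    have "s \<in> d w ` F" and smin: "\<And>b. b \<in> F \<Longrightarrow> s \<le> d w b"
      using FB False by (auto simp: s_def)
    then obtain a where a: "a \<in> F" "d w a = s" by auto
    then have aB: "a \<in> B" "a \<noteq> w" using FB insert by auto
    have s: "s \<in> S" "0 < s" using d_in_S[of w a] S_pos a aB FB by auto
    define N where "N = {b \<in> F. d w b = s}"
    have NB: "b \<in> B" "b \<in> F" "g b \<in> B" if "b \<in> N" for b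
      using that FB G_in[OF g(1)] by (auto simp: N_def)
    define L where "L = (\<lambda>b. g b s) ` {b \<in> N. (b, w) \<in> q}"
    define R where "R = (\<lambda>b. g b s) ` {b \<in> N. (w, b) \<in> q}"
    have LR: "l < r" if "l \<in> L" "r \<in> R" for l r
    proof -
      obtain b c where bc: "b \<in> N" "(b, w) \<in> q" "l = g b s" "c \<in> N" "(w, c) \<in> q" "r = g c s"
        using \<open>l \<in> L\<close> \<open>r \<in> R\<close> by (auto simp: L_def R_def)
      have bcq: "(b, c) \<in> q" using bc q unfolding cLO_iff trans_def by blast
      then have "b \<noteq> c" using cLO_irrefl[OF q] by auto
      have bcB: "b \<in> B" "c \<in> B" "b \<in> F" "c \<in> F" using NB bc by auto
      have bcs: "d b w = s" "d w c = s" using bc(1,4) B_dist_commute[of S b w] by (auto simp: N_def)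
      have "d b c \<le> s" using B_dist_ultrametric[OF pos bcB(1) FB(2) bcB(2)] bcs by simp
      moreover have "\<not> d b c < d b w"
        using cLO_convex(1)[OF q bcB(1,2) FB(2)] bc(2,5) cLO_asym[OF q] by blast
      ultimately have "d b c = s" using bcs by simp
      moreover have "(g b, g c) \<in> lexo" using g(2)[OF bcB(3,4)] bcq by simp
      moreover have "d (g b) (g c) = d b c" using G_isometry[OF g(1) bcB(1,2)] .
      ultimately show ?thesis using bc(3,6) by (simp add: lex_iff)
    qed
    have "finite L" "finite R" using FB by (auto simp: L_def R_def N_def)
    obtain v where v: "\<And>l. l \<in> L \<Longrightarrow> l < v" "\<And>r. r \<in> R \<Longrightarrow> v < r"
      using finite_sets_separated[OF \<open>finite L\<close> \<open>finite R\<close> LR] by blast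
    have gw: "g w \<in> B" using G_in g FB by auto
    \<comment> \<open>The move need not preserve the lexicographic ordering.  A transposition leaves the
       coordinates \<open>g b s\<close> of the points \<open>b \<in> N\<close> alone, as they differ from both \<open>g w s\<close> and \<open>v\<close>.\<close>
    define \<tau> where "\<tau> = Transposition.transpose (g w s) v"
    define k where "k = mv s (g w) \<tau> \<otimes>\<^bsub>G\<^esub> g"
    have mG: "mv s (g w) \<tau> \<in> carrier G" using move_in_G s gw by (auto simp: \<tau>_def)
    have kG: "k \<in> carrier G" using mG g by (simp add: k_def)
    have kw: "k w = (g w)(s := v)"
    proof -
      have "\<tau> (g w s) = v" by (simp add: \<tau>_def)
      then show ?thesis using s gw FB mG g(1) by (simp add: k_def mult_apply move_apply fun_upd_def)
    qed
    have fix_F: "k b = g b" if b: "b \<in> F" for b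
    proof (cases "d w b \<le> s")
      case False
      then show ?thesis
        using b FB mG g(1) G_in[OF g(1)] G_isometry[OF g(1), of b w] B_dist_commute[of S w b]
        by (auto simp: k_def mult_apply move_apply)
    next
      case True
      then have bN: "b \<in> N" using b smin[OF b] by (auto simp: N_def)
      then have wb: "d (g w) (g b) = s" using G_isometry[OF g(1), of w b] FB b by (auto simp: N_def)
      then have ne: "g w s \<noteq> g b s" using B_dist_in(2)[of "g w" S "g b"] gw NB(3)[OF bN] s by force
      have "b \<noteq> w" using b insert by auto
      then have "g b s \<in> L \<union> R" using bN cLO_total[OF q, of b w] NB FB by (auto simp: L_def R_def)
      then have "g b s \<noteq> v" using v by auto
      then have "\<tau> (g b s) = g b s" using ne by (simp add: \<tau>_def Transposition.transpose_def)
      then show ?thesis using b FB mG g(1) by (auto simp: k_def mult_apply move_apply NB[OF bN])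
    qed
    have kaw: "d (g a) (k w) = s"
      using G_isometry[OF kG, of a w] fix_F[OF a(1)] a aB FB B_dist_commute[of S a w] by auto
    have "(g b, k w) \<in> lexo \<longleftrightarrow> (b, w) \<in> q" if b: "b \<in> F" for b
    proof (cases "b \<in> N")
      case True
      then have dbs: "d (g b) (k w) = s"
        using G_isometry[OF kG, of b w] fix_F[OF b] FB b B_dist_commute[of S b w] by (auto simp: N_def)
      then have "(g b, k w) \<in> lexo \<longleftrightarrow> g b s < v"
        using kw s NB[OF True] G_in[OF kG FB(2)] by (auto simp: lex_iff)
      moreover have "b \<noteq> w" using b insert by auto
      then have "g b s \<in> (if (b, w) \<in> q then L else R)"
        using True cLO_total[OF q, of b w] NB FB by (auto simp: L_def R_def)
      ultimately show ?thesis using v by (auto split: if_splits dest: order_less_asym)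
    next
      case False
      then have far: "d w a < d w b" using smin[OF b] a b by (auto simp: N_def order_less_le)
      have bB: "b \<in> B" using b FB by auto
      have "(b, w) \<in> q \<longleftrightarrow> (b, a) \<in> q" using cLO_convex(2)[OF q, of w a b] far FB aB bB by auto
      also have "\<dots> \<longleftrightarrow> (g b, g a) \<in> lexo" using g(2) a b by auto
      also have "\<dots> \<longleftrightarrow> (k b, k a) \<in> lexo" using fix_F a b by auto
      also have "\<dots> \<longleftrightarrow> (k b, k w) \<in> lexo"
        using cLO_convex(2)[OF lex_in_cLO, of "k w" "k a" "k b"] far G_isometry[OF kG] G_in[OF kG] FB aB bB
        by auto
      finally show ?thesis using fix_F b by auto
    qed
    then show ?thesis using suff[OF kG] fix_F by blast
  qed
qed

end

section \<open>Fixed points of the moves in a flow\<close>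

lemma compact_space_Inter_nonempty:
  assumes "compact_space X" "closedin X K" "\<And>i. i \<in> I \<Longrightarrow> closedin X (F i)"
    and "\<And>J. finite J \<Longrightarrow> J \<subseteq> I \<Longrightarrow> \<exists>x \<in> K. \<forall>i \<in> J. x \<in> F i"
  shows "\<exists>x \<in> K. \<forall>i \<in> I. x \<in> F i"
proof -
  have "compactin X K" using assms(1,2) by (rule closedin_compact_space)
  then have fip: "\<forall>\<U>. (\<forall>C\<in>\<U>. closedin X C) \<and> (\<forall>\<F>. finite \<F> \<and> \<F> \<subseteq> \<U> \<longrightarrow> K \<inter> \<Inter>\<F> \<noteq> {}) \<longrightarrow> K \<inter> \<Inter>\<U> \<noteq> {}"
    unfolding compactin_fip by (rule conjunct2)
  have fin: "K \<inter> \<Inter>\<F> \<noteq> {}" if fin: "finite \<F>" and sub: "\<F> \<subseteq> F ` I" for \<F>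
  proof -
    obtain J where J: "J \<subseteq> I" "finite J" "\<F> = F ` J" using finite_subset_image[OF fin sub] by blast
    then show ?thesis using assms(4)[OF J(2,1)] by auto
  qed
  have "K \<inter> \<Inter>(F ` I) \<noteq> {}"
    by (rule fip[THEN spec, THEN mp]) (simp add: assms(3) fin)
  then show ?thesis by auto
qed

locale iso_flow = distance_set +
  fixes Y :: "'y topology" and \<psi> :: "(point \<Rightarrow> point) \<Rightarrow> 'y \<Rightarrow> 'y"
  assumes flow_Y: "flow (iso_group S) (iso_topology S) Y \<psi>"
begin

lemma Y_compact: "compact_space Y" and Y_Hausdorff: "Hausdorff_space Y"
  and Y_nonempty: "topspace Y \<noteq> {}"
  and Y_action: "group_action G (topspace Y) \<psi>"
  and Y_continuous: "continuous_map (prod_topology (iso_topology S) Y) Y (\<lambda>(g, y). \<psi> g y)"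
  using flow_Y by (simp_all add: flow_def)

sublocale Y: group_action G "topspace Y" \<psi>
  by (rule Y_action)

lemma \<psi>_in: "g \<in> carrier G \<Longrightarrow> y \<in> topspace Y \<Longrightarrow> \<psi> g y \<in> topspace Y"
  using Y.element_image by blast

lemma \<psi>_mult:
  "g \<in> carrier G \<Longrightarrow> h \<in> carrier G \<Longrightarrow> y \<in> topspace Y \<Longrightarrow> \<psi> (g \<otimes>\<^bsub>G\<^esub> h) y = \<psi> g (\<psi> h y)"
  by (rule Y.composition_rule)

lemma \<psi>_one: "y \<in> topspace Y \<Longrightarrow> \<psi> \<one>\<^bsub>G\<^esub> y = y"
  using Y.id_eq_one by (metis restrict_apply')

lemma \<psi>_continuous:
  assumes "g \<in> carrier G"
  shows "continuous_map Y Y (\<psi> g)"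
proof -
  have "continuous_map Y (prod_topology (iso_topology S) Y) (\<lambda>y. (g, y))"
    using assms by (intro continuous_map_pairedI) auto
  from continuous_map_compose[OF this Y_continuous] show ?thesis by (simp add: o_def)
qed

text \<open>
  This is joint continuity of the action at the identity, where a neighbourhood of the identity
  is given by a finite set \<open>D\<close> that is to be fixed.
\<close>

lemma near_identity:
  assumes "openin Y W" "y \<in> W"
  shows "\<exists>D W'. finite D \<and> D \<subseteq> B \<and> openin Y W' \<and> y \<in> W' \<and>
    (\<forall>g \<in> carrier G. (\<forall>b \<in> D. g b = b) \<longrightarrow> \<psi> g ` W' \<subseteq> W)"
proof -
  let ?P = "prod_topology (iso_topology S) Y"
  have y: "y \<in> topspace Y" using assms openin_subset by blast
  have o: "openin ?P {p \<in> topspace ?P. (case p of (g, y) \<Rightarrow> \<psi> g y) \<in> W}"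
    by (rule openin_continuous_map_preimage[OF Y_continuous assms(1)])
  have 1: "(\<one>\<^bsub>G\<^esub>, y) \<in> {p \<in> topspace ?P. (case p of (g, y) \<Rightarrow> \<psi> g y) \<in> W}"
    using y assms(2) by (simp add: \<psi>_one)
  obtain U V where UV: "openin (iso_topology S) U" "openin Y V" "\<one>\<^bsub>G\<^esub> \<in> U" "y \<in> V"
    "U \<times> V \<subseteq> {p \<in> topspace ?P. (case p of (g, y) \<Rightarrow> \<psi> g y) \<in> W}"
    using o[unfolded openin_prod_topology_alt, rule_format, OF 1] by (elim exE conjE)
  obtain D where D: "finite D" "D \<subseteq> B"
    "\<forall>h \<in> carrier G. (\<forall>x \<in> D. h x = \<one>\<^bsub>G\<^esub> x) \<longrightarrow> h \<in> U"
    using openin_isoD[OF UV(1,3)] by (elim exE conjE)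
  have "\<psi> g ` V \<subseteq> W" if "g \<in> carrier G" "\<forall>b \<in> D. g b = b" for g
  proof -
    have "g b = \<one>\<^bsub>G\<^esub> b" if "b \<in> D" for b
      using that \<open>\<forall>b \<in> D. g b = b\<close> D(2) one_apply[of b] by auto
    then have "g \<in> U" using D(3) \<open>g \<in> carrier G\<close> by simp
    then show ?thesis using UV(5) by auto
  qed
  then show ?thesis using D UV by (intro exI[of _ D] exI[of _ V]) simp
qed

lemma move_group_fixes:
  assumes "y \<in> topspace Y" "\<And>f. f \<in> moves \<Longrightarrow> \<psi> f y = y" "h \<in> move_group"
  shows "\<psi> h y = y"
proof -
  have "moves \<subseteq> stabilizer G \<psi> y" using assms(2) moves_subset by (auto simp: stabilizer_def)
  then have "move_group \<subseteq> stabilizer G \<psi> y"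
    unfolding move_group_def using Y.stabilizer_subgroup[OF assms(1)] by (rule G.generate_subgroup_incl)
  then show ?thesis using assms(3) by (auto simp: stabilizer_def)
qed

definition move_fixed :: "real \<Rightarrow> point \<Rightarrow> 'y set" where
  "move_fixed t c = {y \<in> topspace Y. \<forall>f \<in> rat_auts. \<psi> (mv t c f) y = y}"

lemma rat_aut_move_in_G: "t \<in> S \<Longrightarrow> c \<in> B \<Longrightarrow> f \<in> rat_auts \<Longrightarrow> mv t c f \<in> carrier G"
  using move_in_G rat_auts_inv(4) by blast

lemma closedin_move_fixed:
  assumes "t \<in> S" "c \<in> B"
  shows "closedin Y (move_fixed t c)"
proof -
  have "closedin Y (\<Inter>f \<in> rat_auts. {y \<in> topspace Y. \<psi> (mv t c f) y = y})"
  proof (rule closedin_INT)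
    show "rat_auts \<noteq> {}" using rat_auts_id by blast
    fix f assume "f \<in> rat_auts"
    then show "closedin Y {y \<in> topspace Y. \<psi> (mv t c f) y = y}"
      using assms by (intro closedin_continuous_maps_eq[OF Y_Hausdorff]) (auto intro: \<psi>_continuous rat_aut_move_in_G)
  qed
  also have "(\<Inter>f \<in> rat_auts. {y \<in> topspace Y. \<psi> (mv t c f) y = y}) = move_fixed t c"
    using rat_auts_id by (auto simp: move_fixed_def)
  finally show ?thesis .
qed

text \<open>
  The closed set \<open>K\<close> is a flow of the group of increasing bijections, acting through the moves about
  one ball, which is extremely amenable.
\<close>

lemma move_fixed_point:
  assumes K: "closedin Y K" "K \<noteq> {}" and tc: "t \<in> S" "c \<in> B"
    and inv: "\<And>f y. f \<in> rat_auts \<Longrightarrow> y \<in> K \<Longrightarrow> \<psi> (mv t c f) y \<in> K"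
  shows "\<exists>y \<in> K. y \<in> move_fixed t c"
proof -
  let ?Z = "subtopology Y K"
  have KY: "K \<subseteq> topspace Y" using K(1) closedin_subset by blast
  have top: "topspace ?Z = K" using KY by auto
  have "\<exists>y \<in> topspace ?Z. \<forall>f \<in> rat_auts. \<psi> (mv t c f) y = y"
  proof (rule rat_auts_extremely_amenable)
    show "compact_space ?Z"
      using closedin_compact_space[OF Y_compact K(1)] by (rule compact_space_subtopology)
    show "Hausdorff_space ?Z" by (rule Hausdorff_space_subtopology[OF Y_Hausdorff])
    show "topspace ?Z \<noteq> {}" using top K(2) by simp
  next
    fix f assume f: "f \<in> rat_auts"
    show "continuous_map ?Z ?Z (\<psi> (mv t c f))"
      using continuous_map_from_subtopology[OF \<psi>_continuous[OF rat_aut_move_in_G[OF tc f]]] inv[OF f] top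
      by (auto simp: continuous_map_in_subtopology)
  next
    fix y assume "y \<in> topspace ?Z"
    then show "\<psi> (mv t c id) y = y" using KY top tc by (auto simp: move_id \<psi>_one)
  next
    fix f g y assume fg: "f \<in> rat_auts" "g \<in> rat_auts" and "y \<in> topspace ?Z"
    then have "y \<in> topspace Y" using KY top by auto
    then show "\<psi> (mv t c (f \<circ> g)) y = \<psi> (mv t c f) (\<psi> (mv t c g) y)"
      using \<psi>_mult[OF rat_aut_move_in_G[OF tc fg(1)] rat_aut_move_in_G[OF tc fg(2)]]
        move_mult[OF tc rat_auts_inv(4)[OF fg(1)] rat_auts_inv(4)[OF fg(2)]] by simp
  next
    fix y W assume "openin ?Z W" "y \<in> W"
    then obtain W0 where W0: "openin Y W0" "W = W0 \<inter> K" "y \<in> W0" "y \<in> K"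
      by (auto simp: openin_subtopology)
    obtain D W' where D: "finite D" "D \<subseteq> B" "openin Y W'" "y \<in> W'"
      "\<forall>g \<in> carrier G. (\<forall>b \<in> D. g b = b) \<longrightarrow> \<psi> g ` W' \<subseteq> W0"
      using near_identity[OF W0(1,3)] by (elim exE conjE)
    show "\<exists>D W'. finite D \<and> openin ?Z W' \<and> y \<in> W' \<and>
        (\<forall>f \<in> rat_auts. (\<forall>q \<in> D. f q = q) \<longrightarrow> \<psi> (mv t c f) ` W' \<subseteq> W)"
    proof (intro exI conjI ballI impI)
      show "finite ((\<lambda>b. b t) ` D)" using D(1) by simp
      show "openin ?Z (W' \<inter> K)" using D(3) by (rule openin_subtopology_Int)
      show "y \<in> W' \<inter> K" using D(4) W0(4) by simp
      fix f assume f: "f \<in> rat_auts" "\<forall>q \<in> (\<lambda>b. b t) ` D. f q = q"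
      have "\<forall>b \<in> D. mv t c f b = b"
      proof
        fix b assume "b \<in> D"
        then have "b \<in> B" "f (b t) = b t" using D(2) f(2) by auto
        then show "mv t c f b = b" by (simp add: move_apply)
      qed
      then have "\<psi> (mv t c f) ` W' \<subseteq> W0" using D(5) rat_aut_move_in_G[OF tc f(1)] by simp
      then show "\<psi> (mv t c f) ` (W' \<inter> K) \<subseteq> W" using inv[OF f(1)] W0(2) by blast
    qed
  qed
  then show ?thesis using top KY by (auto simp: move_fixed_def)
qed

lemma move_fixed_conj:
  assumes "t \<in> S" "c \<in> B" "t' \<in> S" "c' \<in> B" "f \<in> rat_auts" "c\<^sub>0 \<in> B" "mv t' c' f c\<^sub>0 = c"
    and "t < t' \<or> t = t' \<and> \<not> d c\<^sub>0 c' \<le> t" and y: "y \<in> move_fixed t c\<^sub>0"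
  shows "\<psi> (mv t' c' f) y \<in> move_fixed t c"
proof -
  let ?a = "mv t' c' f"
  have a: "?a \<in> carrier G" using rat_aut_move_in_G assms by blast
  have yY: "y \<in> topspace Y" using y by (simp add: move_fixed_def)
  have "\<psi> (mv t c g) (\<psi> ?a y) = \<psi> ?a y" if g: "g \<in> rat_auts" for g
  proof -
    have gG: "mv t c g \<in> carrier G" "mv t c\<^sub>0 g \<in> carrier G" using rat_aut_move_in_G assms g by blast+
    have "mv t c g \<otimes>\<^bsub>G\<^esub> ?a = ?a \<otimes>\<^bsub>G\<^esub> mv t c\<^sub>0 g"
      using gG a move_conj[OF _ assms(1-4) rat_auts_inv(4)[OF assms(5)] assms(6-8)]
      by (intro G_ext) (simp_all add: mult_apply)
    then have "\<psi> (mv t c g) (\<psi> ?a y) = \<psi> ?a (\<psi> (mv t c\<^sub>0 g) y)"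
      using \<psi>_mult[OF gG(1) a yY] \<psi>_mult[OF a gG(2) yY] by simp
    then show ?thesis using y g by (simp add: move_fixed_def)
  qed
  then show ?thesis using \<psi>_in[OF a yY] by (simp add: move_fixed_def)
qed

text \<open>
  Centres are treated one after the other.  A new centre \<open>c'\<close> either has the same ball as a
  previous one, or its moves commute with those of all previous ones and hence preserve the set
  \<open>L\<close> of their common fixed points in \<open>K\<close>.
\<close>

lemma level_fixed_point:
  assumes K: "closedin Y K" "K \<noteq> {}" and t: "t \<in> S"
    and inv: "\<And>f c y. f \<in> rat_auts \<Longrightarrow> c \<in> B \<Longrightarrow> y \<in> K \<Longrightarrow> \<psi> (mv t c f) y \<in> K"
  shows "\<exists>y \<in> K. \<forall>c \<in> B. y \<in> move_fixed t c"
proof (rule compact_space_Inter_nonempty[OF Y_compact K(1)])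
  show "closedin Y (move_fixed t c)" if "c \<in> B" for c using closedin_move_fixed t that by blast
next
  fix C assume "finite C" "C \<subseteq> B"
  then show "\<exists>y \<in> K. \<forall>c \<in> C. y \<in> move_fixed t c"
  proof (induction C rule: finite_induct)
    case empty
    then show ?case using K by auto
  next
    case (insert c' C)
    then have c': "c' \<in> B" and C: "C \<subseteq> B" by auto
    define L where "L = K \<inter> (\<Inter>c \<in> C. {y \<in> topspace Y. y \<in> move_fixed t c})"
    have L: "y \<in> L \<longleftrightarrow> y \<in> K \<and> (\<forall>c \<in> C. y \<in> move_fixed t c)" for y
      by (auto simp: L_def move_fixed_def)
    show ?case
    proof (cases "\<exists>c \<in> C. d c c' \<le> t")
      case True
      then obtain c where c: "c \<in> C" "d c c' \<le> t" by blast
      have cB: "c \<in> B" using c C by auto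
      have "d x c \<le> t \<longleftrightarrow> d x c' \<le> t" if "x \<in> B" for x
        using B_dist_ultrametric[OF pos that cB c'] B_dist_ultrametric[OF pos that c' cB] c(2)
          B_dist_commute[of S c c'] by auto
      then have "mv t c = mv t c'" by (simp add: move_def fun_eq_iff restrict_def)
      then have "move_fixed t c = move_fixed t c'" by (simp add: move_fixed_def)
      then show ?thesis using insert.IH C c by auto
    next
      case False
      have "\<exists>y \<in> L. y \<in> move_fixed t c'"
      proof (rule move_fixed_point[OF _ _ t c'])
        show "L \<noteq> {}" using insert.IH C L by auto
        show "closedin Y L"
        proof (cases "C = {}")
          case True
          then show ?thesis using K by (simp add: L_def)
        next
          case False
          have "{y \<in> topspace Y. y \<in> move_fixed t c} = move_fixed t c" for c by (auto simp: move_fixed_def)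
          then show ?thesis unfolding L_def using False closedin_move_fixed[OF t] C K
            by (intro closedin_Int closedin_INT) auto
        qed
      next
        fix f y assume f: "f \<in> rat_auts" and y: "y \<in> L"
        have "\<psi> (mv t c' f) y \<in> move_fixed t c" if c: "c \<in> C" for c
        proof (rule move_fixed_conj[OF t _ t c' f])
          show "c \<in> B" "c \<in> B" using c C by auto
          have far: "\<not> d c c' \<le> t" using c False by blast
          then show "t < t \<or> t = t \<and> \<not> d c c' \<le> t" by simp
          show "mv t c' f c = c" using far \<open>c \<in> B\<close> by (simp add: move_apply)
          show "y \<in> move_fixed t c" using y L c by blast
        qed
        then show "\<psi> (mv t c' f) y \<in> L" using y L inv[OF f c'] by blast
      qed
      then show ?thesis using L by blast
    qed
  qed
qed

text \<open>
  Levels are added in increasing order.  All centres of the lower levels have to be treated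
  before the next level \<open>t'\<close> is added, because a move at level \<open>t'\<close> permutes the balls of the lower levels
  and thus preserves only the set of the points that are fixed by the moves about all of them.
\<close>

lemma moves_fixed_point:
  assumes K: "closedin Y K" "K \<noteq> {}"
    and inv: "\<And>f y. f \<in> moves \<Longrightarrow> y \<in> K \<Longrightarrow> \<psi> f y \<in> K"
  shows "\<exists>y \<in> K. \<forall>h \<in> move_group. \<psi> h y = y"
proof -
  have inv': "\<psi> (mv t c f) y \<in> K" if "t \<in> S" "c \<in> B" "f \<in> rat_auts" "y \<in> K" for t c f y
  proof (rule inv)
    show "mv t c f \<in> moves" unfolding moves_def using that by blast
  qed (rule that(4))
  have "\<exists>y \<in> K. \<forall>p \<in> S \<times> B. y \<in> (case p of (t, c) \<Rightarrow> move_fixed t c)"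
  proof (rule compact_space_Inter_nonempty[OF Y_compact K(1)])
    show "closedin Y (case p of (t, c) \<Rightarrow> move_fixed t c)" if "p \<in> S \<times> B" for p
      using that closedin_move_fixed by auto
  next
    have levels: "\<exists>y \<in> K. \<forall>t \<in> T. \<forall>c \<in> B. y \<in> move_fixed t c" if "finite T" "T \<subseteq> S" for T
      using that
    proof (induction T rule: finite_linorder_max_induct)
      case empty
      then show ?case using K by auto
    next
      case (insert t' T)
      then have t': "t' \<in> S" and T: "T \<subseteq> S" by auto
      define L where "L = K \<inter> (\<Inter>p \<in> T \<times> B. case p of (t, c) \<Rightarrow> move_fixed t c)"
      have L: "y \<in> L \<longleftrightarrow> y \<in> K \<and> (\<forall>t \<in> T. \<forall>c \<in> B. y \<in> move_fixed t c)" for y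
        by (auto simp: L_def)
      have "\<exists>y \<in> L. \<forall>c \<in> B. y \<in> move_fixed t' c"
      proof (rule level_fixed_point[OF _ _ t'])
        show "L \<noteq> {}" using insert.IH T L by auto
        show "closedin Y L"
        proof (cases "T = {}")
          case True
          then show ?thesis using K by (simp add: L_def)
        next
          case False
          then have "T \<times> B \<noteq> {}" using B_nonempty by auto
          then show ?thesis unfolding L_def using closedin_move_fixed T K
            by (intro closedin_Int closedin_INT) auto
        qed
      next
        fix f c' y assume f: "f \<in> rat_auts" and c': "c' \<in> B" and y: "y \<in> L"
        have a: "mv t' c' f \<in> carrier G" by (rule rat_aut_move_in_G[OF t' c' f])
        have "\<psi> (mv t' c' f) y \<in> move_fixed t c" if tc: "t \<in> T" "c \<in> B" for t c
        proof (rule move_fixed_conj[OF _ tc(2) t' c' f])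
          let ?c = "(inv\<^bsub>G\<^esub> (mv t' c' f)) c"
          show "t \<in> S" using tc T by auto
          show cB: "?c \<in> B" using a tc G_in by auto
          show "mv t' c' f ?c = c" by (rule inv_apply(2)[OF a tc(2)])
          show "t < t' \<or> t = t' \<and> \<not> d ?c c' \<le> t" using insert.hyps tc by auto
          show "y \<in> move_fixed t ?c" using y L tc cB by blast
        qed
        then show "\<psi> (mv t' c' f) y \<in> L" using y L inv'[OF t' c' f] by blast
      qed
      then show ?case using L by blast
    qed
    fix J assume "finite J" "J \<subseteq> S \<times> B"
    then have "\<exists>y \<in> K. \<forall>t \<in> fst ` J. \<forall>c \<in> B. y \<in> move_fixed t c" by (intro levels) auto
    then obtain y where y: "y \<in> K" "\<forall>t \<in> fst ` J. \<forall>c \<in> B. y \<in> move_fixed t c" by blast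
    have "\<forall>p \<in> J. y \<in> (case p of (t, c) \<Rightarrow> move_fixed t c)"
    proof
      fix p assume "p \<in> J"
      then have "fst p \<in> fst ` J" "snd p \<in> B" using \<open>J \<subseteq> S \<times> B\<close> by auto
      then show "y \<in> (case p of (t, c) \<Rightarrow> move_fixed t c)" 
        using y(2)[THEN bspec, THEN bspec] by (simp only: case_prod_unfold)
    qed
    then show "\<exists>y \<in> K. \<forall>p \<in> J. y \<in> (case p of (t, c) \<Rightarrow> move_fixed t c)" using y(1) by blast
  qed
  then obtain y where y: "y \<in> K" "\<forall>p \<in> S \<times> B. y \<in> (case p of (t, c) \<Rightarrow> move_fixed t c)" by blast
  have "\<psi> f y = y" if "f \<in> moves" for f
  proof -
    obtain t c g where f: "f = mv t c g" "t \<in> S" "c \<in> B" "g \<in> rat_auts"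
      using \<open>f \<in> moves\<close> unfolding moves_def by blast
    then have "y \<in> move_fixed t c" using y(2) by blast
    then show ?thesis using f by (simp add: move_fixed_def)
  qed
  then have "\<forall>h \<in> move_group. \<psi> h y = y" using move_group_fixes closedin_subset[OF K(1)] y(1) by blast
  then show ?thesis using y(1) by blast
qed

end

section \<open>Convex orderings fixed by the moves\<close>

definition flip :: "real set \<Rightarrow> real set \<Rightarrow> point rel \<Rightarrow> point rel" where
  "flip S E r = {(x, y) \<in> B_pts S \<times> B_pts S. if B_dist S x y \<in> E then (y, x) \<in> r else (x, y) \<in> r}"

context distance_set
begin

abbreviation "fl \<equiv> flip S"

lemma flip_iff:
  "(x, y) \<in> fl E r \<longleftrightarrow> x \<in> B \<and> y \<in> B \<and> (if d x y \<in> E then (y, x) \<in> r else (x, y) \<in> r)"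
  by (simp add: flip_def)

text \<open>
  Flips preserve transitivity because the three sides of an equilateral triangle are all
  reversed or all kept.
\<close>

lemma flip_in:
  assumes r: "r \<in> cLO S"
  shows "fl E r \<in> cLO S"
proof (rule cLO_I)
  show "fl E r \<subseteq> B \<times> B" by (auto simp: flip_def)
  show "(x, x) \<notin> fl E r" for x using cLO_irrefl[OF r] by (simp add: flip_iff)
next
  fix x y assume "x \<in> B" "y \<in> B" "x \<noteq> y"
  then show "(x, y) \<in> fl E r \<longleftrightarrow> (y, x) \<notin> fl E r"
    using cLO_total[OF r, of x y] B_dist_commute[of S x y] by (simp add: flip_iff)
next
  fix x y z assume a: "x \<in> B" "y \<in> B" "z \<in> B" "d x y < d x z"
  then show "(x, z) \<in> fl E r \<longleftrightarrow> (y, z) \<in> fl E r"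
    using cLO_convex[OF r a] isosceles[OF a] by (simp add: flip_iff)
next
  fix x y z assume a: "d x y = d y z" "d x z = d y z" "(x, y) \<in> fl E r" "(y, z) \<in> fl E r"
  have "trans r" using r by (simp add: cLO_iff)
  then show "(x, z) \<in> fl E r"
    using a by (auto simp: flip_iff split: if_splits dest: transD)
qed

lemma flip_flip: "r \<in> cLO S \<Longrightarrow> fl E (fl E r) = r"
  using cLO_subset[of r] B_dist_commute[of S] by (auto simp: flip_def)

lemma act_flip:
  assumes r: "r \<in> cLO S" and g: "g \<in> carrier G"
  shows "act g (fl E r) = fl E (act g r)"
proof -
  let ?i = "inv\<^bsub>G\<^esub> g"
  have i: "?i \<in> carrier G" using g by simp
  have "(x, y) \<in> act g (fl E r) \<longleftrightarrow> (x, y) \<in> fl E (act g r)" for x y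
    using act_iff[OF r] act_iff[OF flip_in[OF r]] G_isometry[OF i, of x y] G_in[OF i]
    by (auto simp: flip_iff)
  then show ?thesis by auto
qed

lemma flip_basic:
  assumes "r \<in> cLO S" "q \<in> cLO_basic S F r" "F \<subseteq> B"
  shows "fl E q \<in> cLO_basic S F (fl E r)"
  using assms flip_in by (auto simp: cLO_basic_iff flip_iff)

lemma flip_continuous: "continuous_map (cLO_topology S) (cLO_topology S) (fl E)"
  unfolding continuous_map_def
proof (intro conjI allI impI)
  show "fl E \<in> topspace (cLO_topology S) \<rightarrow> topspace (cLO_topology S)" using flip_in by simp
  fix U assume U: "openin (cLO_topology S) U"
  show "openin (cLO_topology S) {r \<in> topspace (cLO_topology S). fl E r \<in> U}"
    unfolding openin_cLO_iff
  proof (intro conjI ballI)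
    fix r assume "r \<in> {r \<in> topspace (cLO_topology S). fl E r \<in> U}"
    then have r: "r \<in> cLO S" "fl E r \<in> U" by auto
    then obtain F where F: "finite F" "F \<subseteq> B" "cLO_basic S F (fl E r) \<subseteq> U"
      using U[unfolded openin_cLO_iff, THEN conjunct2, THEN bspec, OF r(2)] by blast
    then have "cLO_basic S F r \<subseteq> {r \<in> topspace (cLO_topology S). fl E r \<in> U}"
      using flip_basic[OF r(1) _ F(2)] by (auto simp: cLO_basic_iff)
    then show "\<exists>F. finite F \<and> F \<subseteq> B \<and> cLO_basic S F r \<subseteq> {r \<in> topspace (cLO_topology S). fl E r \<in> U}"
      using F by blast
  qed auto
qed

text \<open>
  Pairs \<open>x < y\<close> at the same distance, in the lexicographic ordering, are all equivalent under the
  moves.  So a fixed ordering either agrees with the lexicographic one on all of them or reverses them all.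
\<close>

lemma move_group_fixed_is_flip:
  assumes r: "r \<in> cLO S" and fixed: "\<And>h. h \<in> move_group \<Longrightarrow> act h r = r"
  shows "\<exists>E. r = fl E lexo"
proof -
  define E where "E = {d x y | x y. (x, y) \<in> lexo \<and> (y, x) \<in> r}"
  have key: "(y, x) \<in> r \<longleftrightarrow> d x y \<in> E" if xy: "(x, y) \<in> lexo" for x y
  proof
    show "d x y \<in> E" if "(y, x) \<in> r" using that xy by (auto simp: E_def)
    assume "d x y \<in> E"
    then obtain x' y' where xy': "d x' y' = d x y" "(x', y') \<in> lexo" "(y', x') \<in> r"
      by (auto simp: E_def)
    obtain h where h: "h \<in> move_group" "h x' = x" "h y' = y"
      using move_group_two_homogeneous[OF xy'(2) xy xy'(1)] by blast
    have "x' \<in> B" "y' \<in> B" using xy'(2) by (auto simp: lex_iff)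
    then have "(h y', h x') \<in> act h r"
      using act_image_iff[OF r] h(1) move_group_subset xy'(3) by blast
    then show "(y, x) \<in> r" using h fixed by simp
  qed
  have "(x, y) \<in> r \<longleftrightarrow> (x, y) \<in> fl E lexo" for x y
  proof (cases "x \<in> B \<and> y \<in> B \<and> x \<noteq> y")
    case False
    then show ?thesis
      using cLO_subset[OF r] cLO_irrefl[OF r] cLO_irrefl[OF lex_in_cLO] by (auto simp: flip_iff)
  next
    case True
    then have T: "x \<in> B" "y \<in> B" "x \<noteq> y" by auto
    show ?thesis
    proof (cases "(x, y) \<in> lexo")
      case xy: True
      then have "(y, x) \<notin> lexo" using cLO_asym[OF lex_in_cLO] by blast
      then show ?thesis using key[OF xy] xy T cLO_total[OF r T] by (simp add: flip_iff)
    next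
      case False
      then have yx: "(y, x) \<in> lexo" using lex_total[OF T] by blast
      then show ?thesis using key[OF yx] False T B_dist_commute[of S x y] by (simp add: flip_iff)
    qed
  qed
  then show ?thesis by auto
qed

lemma lex_orbit_meets_basic:
  assumes "q \<in> cLO S" "finite F" "F \<subseteq> B"
  shows "\<exists>g \<in> carrier G. act g lexo \<in> cLO_basic S F q"
proof -
  obtain g where g: "g \<in> carrier G" "\<forall>x \<in> F. \<forall>y \<in> F. (g x, g y) \<in> lexo \<longleftrightarrow> (x, y) \<in> q"
    using convex_order_realized_in_lex[OF assms] by blast
  then have "act (inv\<^bsub>G\<^esub> g) lexo \<in> cLO_basic S F q"
    using assms(3) act_in[OF lex_in_cLO] act_iff[OF lex_in_cLO] by (auto simp: cLO_basic_iff)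
  then show ?thesis using g(1) by blast
qed

lemma lex_orbit_dense: "cLO_topology S closure_of orbit G act lexo = cLO S"
proof
  show "cLO_topology S closure_of orbit G act lexo \<subseteq> cLO S"
    using closure_of_subset_topspace[of "cLO_topology S"] by simp
  show "cLO S \<subseteq> cLO_topology S closure_of orbit G act lexo"
  proof
    fix q assume q: "q \<in> cLO S"
    show "q \<in> cLO_topology S closure_of orbit G act lexo"
      unfolding in_closure_of
    proof (intro conjI allI impI)
      fix W assume "q \<in> W \<and> openin (cLO_topology S) W"
      then have W: "q \<in> W" "openin (cLO_topology S) W" by auto
      obtain F where F: "finite F" "F \<subseteq> B" "cLO_basic S F q \<subseteq> W"
        using W(2)[unfolded openin_cLO_iff, THEN conjunct2, THEN bspec, OF W(1)] by blast
      obtain g where "g \<in> carrier G" "act g lexo \<in> cLO_basic S F q"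
        using lex_orbit_meets_basic[OF q F(1,2)] by blast
      then show "\<exists>y. y \<in> orbit G act lexo \<and> y \<in> W" using F(3) by (auto simp: orbit_def)
    qed (use q in simp)
  qed
qed

end

sublocale distance_set \<subseteq> cLO: iso_flow S "cLO_topology S" "cLO_action S"
  by unfold_locales (rule flow_cLO)

section \<open>The universal minimal flow\<close>

context iso_flow
begin

lemma orbit_subset: "y \<in> topspace Y \<Longrightarrow> orbit G \<psi> y \<subseteq> topspace Y"
  using \<psi>_in by (auto simp: orbit_def)

lemma orbit_closure_invariant:
  assumes "y \<in> topspace Y" "g \<in> carrier G" "z \<in> Y closure_of orbit G \<psi> y"
  shows "\<psi> g z \<in> Y closure_of orbit G \<psi> y"
proof -
  have "\<psi> g ` orbit G \<psi> y \<subseteq> orbit G \<psi> y"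
  proof
    fix u assume "u \<in> \<psi> g ` orbit G \<psi> y"
    then obtain h where h: "h \<in> carrier G" "u = \<psi> g (\<psi> h y)" by (auto simp: orbit_def)
    then have "u = \<psi> (g \<otimes>\<^bsub>G\<^esub> h) y" "g \<otimes>\<^bsub>G\<^esub> h \<in> carrier G"
      using \<psi>_mult[OF assms(2) h(1) assms(1)] assms(2) by auto
    then show "u \<in> orbit G \<psi> y" unfolding orbit_def by blast
  qed
  then have "Y closure_of (\<psi> g ` orbit G \<psi> y) \<subseteq> Y closure_of orbit G \<psi> y" by (rule closure_of_mono)
  then show ?thesis
    using continuous_map_image_closure_subset[OF \<psi>_continuous[OF assms(2)], of "orbit G \<psi> y"] assms(3)
    by blast
qed

end

context distance_set
begin

text \<open>
  An orbit closure \<open>K\<close> contains a point fixed by the moves, which is a flip of the lexicographic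
  ordering.  Its orbit is dense since the lexicographic ordering has a dense orbit and flips
  commute with the action.
\<close>

lemma minimal_cLO: "minimal_flow G (iso_topology S) (cLO_topology S) act"
  unfolding minimal_flow_def
proof (intro conjI ballI)
  show "flow G (iso_topology S) (cLO_topology S) act" by (rule flow_cLO)
  fix r assume "r \<in> topspace (cLO_topology S)"
  then have r: "r \<in> cLO S" by simp
  let ?K = "cLO_topology S closure_of orbit G act r"
  have inv: "act g q \<in> ?K" if "g \<in> carrier G" "q \<in> ?K" for g q
    using cLO.orbit_closure_invariant[of r g q] r that by simp
  have sub: "?K \<subseteq> cLO S" using closure_of_subset_topspace[of "cLO_topology S"] by simp
  have "orbit G act r \<subseteq> ?K"
    using closure_of_subset[of "orbit G act r" "cLO_topology S"] cLO.orbit_subset[of r] r by simp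
  moreover have "act \<one>\<^bsub>G\<^esub> r \<in> orbit G act r" by (auto simp: orbit_def)
  ultimately have "?K \<noteq> {}" by blast
  moreover have "act f q \<in> ?K" if "f \<in> moves" "q \<in> ?K" for f q
    using inv that moves_subset by blast
  ultimately obtain q where q: "q \<in> ?K" "\<forall>h \<in> move_group. act h q = q"
    using cLO.moves_fixed_point[of ?K] closedin_closure_of by blast
  then obtain E where E: "q = fl E lexo" using move_group_fixed_is_flip[of q] sub by blast
  have "p \<in> ?K" if p: "p \<in> cLO S" for p
  proof -
    have "p \<in> cLO_topology S closure_of ?K"
      unfolding in_closure_of[of p]
    proof (intro conjI allI impI)
      fix W assume "p \<in> W \<and> openin (cLO_topology S) W"
      then have W: "p \<in> W" "openin (cLO_topology S) W" by auto
      obtain F where F: "finite F" "F \<subseteq> B" "cLO_basic S F p \<subseteq> W"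
        using W(2)[unfolded openin_cLO_iff, THEN conjunct2, THEN bspec, OF W(1)] by blast
      obtain g where g: "g \<in> carrier G" "act g lexo \<in> cLO_basic S F (fl E p)"
        using lex_orbit_meets_basic[OF flip_in[OF p] F(1,2)] by blast
      have "act g q = fl E (act g lexo)" using act_flip[OF lex_in_cLO g(1)] E by simp
      also have "\<dots> \<in> cLO_basic S F (fl E (fl E p))"
        by (rule flip_basic[OF flip_in[OF p] g(2) F(2)])
      also have "\<dots> = cLO_basic S F p" by (simp add: flip_flip[OF p])
      finally have "act g q \<in> W" using F(3) by blast
      then show "\<exists>y. y \<in> ?K \<and> y \<in> W" using inv[OF g(1) q(1)] by blast
    qed (use p in simp)
    then show ?thesis by simp
  qed
  then show "?K = topspace (cLO_topology S)" using sub by auto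
qed

text \<open>
  The image of the lexicographic ordering is fixed by the moves, hence a flip of it.  The same flip
  then works on the whole orbit, which is dense.
\<close>

lemma cLO_endomorphism_is_flip:
  assumes "flow_hom G (cLO_topology S) act (cLO_topology S) act \<rho>"
  shows "\<exists>E. \<forall>r \<in> cLO S. \<rho> r = fl E r"
proof -
  have cont: "continuous_map (cLO_topology S) (cLO_topology S) \<rho>"
    and equiv: "\<And>g r. g \<in> carrier G \<Longrightarrow> r \<in> cLO S \<Longrightarrow> \<rho> (act g r) = act g (\<rho> r)"
    using assms by (auto simp: flow_hom_def)
  have in_cLO: "\<rho> r \<in> cLO S" if "r \<in> cLO S" for r
    using continuous_map_image_subset_topspace[OF cont] that by auto
  have lex_fixed: "act h lexo = lexo" if h: "h \<in> move_group" for h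
  proof -
    have hG: "h \<in> carrier G" using h move_group_subset by blast
    have i: "inv\<^bsub>G\<^esub> h \<in> carrier G" using hG by simp
    have "(x, y) \<in> act h lexo \<longleftrightarrow> (x, y) \<in> lexo" if B: "x \<in> B" "y \<in> B" for x y
      using move_group_lex_iff[OF h G_in[OF i B(1)] G_in[OF i B(2)]] B
      by (simp add: act_iff[OF lex_in_cLO] inv_apply[OF hG])
    moreover have "act h lexo \<subseteq> B \<times> B" "lexo \<subseteq> B \<times> B"
      using cLO_subset act_in[OF lex_in_cLO hG] lex_in_cLO by blast+
    ultimately show ?thesis by auto
  qed
  have "act h (\<rho> lexo) = \<rho> lexo" if "h \<in> move_group" for h
    using equiv[OF _ lex_in_cLO, of h] lex_fixed[OF that] that move_group_subset by auto
  then obtain E where E: "\<rho> lexo = fl E lexo"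
    using move_group_fixed_is_flip[OF in_cLO[OF lex_in_cLO]] by blast
  have "\<rho> r = fl E r" if r: "r \<in> cLO S" for r
  proof (rule forall_in_closure_of_eq[OF _ Hausdorff_cLO cont flip_continuous])
    show "r \<in> cLO_topology S closure_of orbit G act lexo" using lex_orbit_dense r by simp
    fix q assume "q \<in> orbit G act lexo"
    then obtain g where g: "g \<in> carrier G" "q = act g lexo" by (auto simp: orbit_def)
    then show "\<rho> q = fl E q" using equiv[OF g(1) lex_in_cLO] E act_flip[OF lex_in_cLO g(1)] by simp
  qed
  then show ?thesis by blast
qed

end

context iso_flow
begin

definition graph_closure :: "'y \<Rightarrow> (point rel \<times> 'y) set" where
  "graph_closure y = prod_topology (cLO_topology S) Y closure_of
     {(act g lexo, \<psi> g y) | g. g \<in> carrier G}"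

text \<open>
  Suppose that \<open>z\<close> and \<open>z'\<close> differ and choose disjoint neighbourhoods \<open>W\<close> and \<open>W'\<close>.  There are \<open>g\<close> and
  \<open>g'\<close> such that \<open>g lexo\<close> and \<open>g' lexo\<close> agree with \<open>r\<close> on a large finite set \<open>D\<close>, while \<open>g y\<close> is close to
  \<open>z\<close> and \<open>g' y\<close> close to \<open>z'\<close>.  Then \<open>inv g' g\<close> preserves the lexicographic ordering on \<open>inv g ` D\<close> and
  agrees there with some \<open>h\<close> generated by moves.  As \<open>h\<close> fixes \<open>y\<close>, the isometry
  \<open>v = g' h (inv g)\<close> takes \<open>g y\<close> to \<open>g' y\<close>; but \<open>v\<close> fixes \<open>D\<close> pointwise, so it moves \<open>g y\<close> only within \<open>W\<close>.
\<close>

lemma graph_closure_single_valued: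
  assumes y: "y \<in> topspace Y" and fixed: "\<And>h. h \<in> move_group \<Longrightarrow> \<psi> h y = y"
    and rz: "(r, z) \<in> graph_closure y" "(r, z') \<in> graph_closure y"
  shows "z = z'"
proof (rule ccontr)
  assume "z \<noteq> z'"
  let ?P = "prod_topology (cLO_topology S) Y"
  have mem: "r \<in> cLO S" "z \<in> topspace Y" "z' \<in> topspace Y"
    using rz closure_of_subset_topspace[of ?P] unfolding graph_closure_def by auto
  obtain W W' where W: "openin Y W" "openin Y W'" "z \<in> W" "z' \<in> W'" "disjnt W W'"
    using Y_Hausdorff mem(2,3) \<open>z \<noteq> z'\<close> unfolding Hausdorff_space_def by metis
  obtain D V where D: "finite D" "D \<subseteq> B" and V: "openin Y V" "z \<in> V"
    and DV: "\<forall>g \<in> carrier G. (\<forall>b \<in> D. g b = b) \<longrightarrow> \<psi> g ` V \<subseteq> W"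
    using near_identity[OF W(1,3)] by (elim exE conjE)
  have meet: "\<exists>g \<in> carrier G. act g lexo \<in> cLO_basic S D r \<and> \<psi> g y \<in> U"
    if U: "openin Y U" "u \<in> U" "(r, u) \<in> graph_closure y" for u U
  proof -
    have "openin ?P (cLO_basic S D r \<times> U)"
      using openin_cLO_basic[OF D] U(1) by (simp add: openin_prod_Times_iff)
    then have "(r, u) \<in> cLO_basic S D r \<times> U \<and> openin ?P (cLO_basic S D r \<times> U)"
      using mem(1) U(2) by (simp add: cLO_basic_iff)
    with U(3)[unfolded graph_closure_def in_closure_of, THEN conjunct2, THEN spec, of "cLO_basic S D r \<times> U"]
    obtain p where "p \<in> {(act g lexo, \<psi> g y) | g. g \<in> carrier G}" "p \<in> cLO_basic S D r \<times> U"
      by (elim impE exE conjE) auto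
    then show ?thesis by blast
  qed
  obtain g where g: "g \<in> carrier G" "act g lexo \<in> cLO_basic S D r" "\<psi> g y \<in> V"
    using meet[OF V rz(1)] by blast
  obtain g' where g': "g' \<in> carrier G" "act g' lexo \<in> cLO_basic S D r" "\<psi> g' y \<in> W'"
    using meet[OF W(2,4) rz(2)] by blast
  let ?i = "inv\<^bsub>G\<^esub> g" and ?i' = "inv\<^bsub>G\<^esub> g'"
  have i: "?i \<in> carrier G" "?i' \<in> carrier G" using g g' by auto
  define k where "k = ?i' \<otimes>\<^bsub>G\<^esub> g"
  have k: "k \<in> carrier G" using i g by (simp add: k_def)
  have ki: "k (?i a) = ?i' a" if "a \<in> B" for a
    using that i g G_in[OF i(1)] by (simp add: k_def mult_apply inv_apply)
  have "(k x, k x') \<in> lexo \<longleftrightarrow> (x, x') \<in> lexo" if "x \<in> ?i ` D" "x' \<in> ?i ` D" for x x'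
  proof -
    obtain a a' where a: "a \<in> D" "a' \<in> D" "x = ?i a" "x' = ?i a'"
      using \<open>x \<in> ?i ` D\<close> \<open>x' \<in> ?i ` D\<close> by blast
    then have aB: "a \<in> B" "a' \<in> B" using D by auto
    have "(?i a, ?i a') \<in> lexo \<longleftrightarrow> (a, a') \<in> r" "(?i' a, ?i' a') \<in> lexo \<longleftrightarrow> (a, a') \<in> r"
      using g(2) g'(2) a(1,2) aB act_iff[OF lex_in_cLO] by (auto simp: cLO_basic_iff)
    then show ?thesis using a(3,4) ki aB by simp
  qed
  moreover have iD: "finite (?i ` D)" "?i ` D \<subseteq> B" using D G_in[OF i(1)] by auto
  ultimately obtain h where h: "h \<in> move_group" "\<forall>x \<in> ?i ` D. h x = k x"
    using move_group_dense_in_lex_automorphisms[OF k iD] by blast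
  have hG: "h \<in> carrier G" using h move_group_subset by blast
  define v where "v = g' \<otimes>\<^bsub>G\<^esub> h \<otimes>\<^bsub>G\<^esub> ?i"
  have vG: "v \<in> carrier G" using g' hG i by (simp add: v_def)
  have "v a = a" if a: "a \<in> D" for a
  proof -
    have aB: "a \<in> B" using a D by auto
    have "v a = g' (h (?i a))" using g' hG i aB G_in by (simp add: v_def mult_apply)
    also have "h (?i a) = ?i' a" using h(2) a ki[OF aB] by simp
    finally show ?thesis using inv_apply(2)[OF g'(1) aB] by simp
  qed
  then have "\<psi> v ` V \<subseteq> W" using DV vG by blast
  then have "\<psi> v (\<psi> g y) \<in> W" using g(3) by blast
  moreover have "\<psi> v (\<psi> g y) = \<psi> g' y"
  proof -
    have "v \<otimes>\<^bsub>G\<^esub> g = g' \<otimes>\<^bsub>G\<^esub> h" using g(1) g'(1) hG i by (simp add: v_def G.m_assoc)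
    then have "\<psi> v (\<psi> g y) = \<psi> g' (\<psi> h y)"
      using \<psi>_mult[OF vG g(1) y] \<psi>_mult[OF g'(1) hG y] by simp
    then show ?thesis using fixed[OF h(1)] by simp
  qed
  ultimately show False using g'(3) W(5) by (auto simp: disjnt_iff)
qed

text \<open>
  Since the orbit of the lexicographic ordering is dense, the first projection maps the compact set
  \<open>graph_closure y\<close> onto the convex orderings.  It is injective by
  \<open>graph_closure_single_valued\<close>, hence a homeomorphism, and its inverse followed by the second
  projection is the homomorphism.
\<close>

lemma flow_hom_from_cLO: "\<exists>\<pi>. flow_hom G (cLO_topology S) act Y \<psi> \<pi>"
proof -
  obtain y where y: "y \<in> topspace Y" and fixed: "\<And>h. h \<in> move_group \<Longrightarrow> \<psi> h y = y"
    using moves_fixed_point[OF closedin_topspace Y_nonempty] \<psi>_in moves_subset by blast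
  let ?P = "prod_topology (cLO_topology S) Y"
  let ?O = "{(act g lexo, \<psi> g y) | g. g \<in> carrier G}"
  let ?\<Gamma> = "graph_closure y"
  let ?X = "subtopology ?P ?\<Gamma>"
  have O: "?O \<subseteq> topspace ?P" using act_in[OF lex_in_cLO] \<psi>_in y by auto
  have cl: "closedin ?P ?\<Gamma>" by (simp add: graph_closure_def)
  have topX: "topspace ?X = ?\<Gamma>" using closedin_subset[OF cl] by auto
  have compP: "compact_space ?P" using compact_cLO Y_compact by (simp add: compact_space_prod_topology)
  have compX: "compact_space ?X"
    using closedin_compact_space[OF compP cl] by (rule compact_space_subtopology)
  have fstc: "continuous_map ?X (cLO_topology S) fst"
    by (rule continuous_map_from_subtopology[OF continuous_map_fst])
  have "compactin (cLO_topology S) (fst ` ?\<Gamma>)"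
    using image_compactin[OF compX[unfolded compact_space_def] fstc] topX by simp
  then have "closedin (cLO_topology S) (fst ` ?\<Gamma>)" by (rule compactin_imp_closedin[OF Hausdorff_cLO])
  moreover have "orbit G act lexo \<subseteq> fst ` ?\<Gamma>"
  proof
    fix q assume "q \<in> orbit G act lexo"
    then obtain g where g: "g \<in> carrier G" "q = act g lexo" by (auto simp: orbit_def)
    then have "(q, \<psi> g y) \<in> ?O" by blast
    then have "(q, \<psi> g y) \<in> ?\<Gamma>" using closure_of_subset[OF O] unfolding graph_closure_def by blast
    then show "q \<in> fst ` ?\<Gamma>" by force
  qed
  ultimately have "cLO_topology S closure_of orbit G act lexo \<subseteq> fst ` ?\<Gamma>"
    by (intro closure_of_minimal)
  then have onto: "fst ` topspace ?X = topspace (cLO_topology S)"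
    using lex_orbit_dense topX closedin_subset[OF cl] by auto
  have "inj_on fst (topspace ?X)"
    unfolding topX inj_on_def using graph_closure_single_valued[OF y fixed] by auto
  then have "homeomorphic_map ?X (cLO_topology S) fst"
    using T1_Spaces.continuous_imp_closed_map[OF fstc compX Hausdorff_cLO] fstc onto
    by (intro bijective_closed_imp_homeomorphic_map)
  then obtain \<sigma> where \<sigma>: "homeomorphic_maps ?X (cLO_topology S) fst \<sigma>"
    unfolding homeomorphic_map_maps by blast
  have \<sigma>c: "continuous_map (cLO_topology S) ?X \<sigma>" and fst\<sigma>: "\<And>r. r \<in> cLO S \<Longrightarrow> fst (\<sigma> r) = r"
    using \<sigma> by (auto simp: homeomorphic_maps_def)
  define \<pi> where "\<pi> = snd \<circ> \<sigma>"
  have \<pi>c: "continuous_map (cLO_topology S) Y \<pi>"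
    unfolding \<pi>_def
    by (rule continuous_map_compose[OF \<sigma>c continuous_map_from_subtopology[OF continuous_map_snd]])
  have \<pi>\<Gamma>: "(r, \<pi> r) \<in> ?\<Gamma>" if r: "r \<in> cLO S" for r
  proof -
    have "\<sigma> r \<in> ?\<Gamma>" using continuous_map_image_subset_topspace[OF \<sigma>c] r topX by auto
    moreover have "\<sigma> r = (r, \<pi> r)" using fst\<sigma>[OF r] by (simp add: \<pi>_def prod_eq_iff)
    ultimately show ?thesis by simp
  qed
  have "\<pi> (act g r) = \<psi> g (\<pi> r)" if g: "g \<in> carrier G" and r: "r \<in> cLO S" for g r
  proof (rule graph_closure_single_valued[OF y fixed \<pi>\<Gamma>[OF act_in[OF r g]]])
    let ?T = "\<lambda>p. (act g (fst p), \<psi> g (snd p))"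
    have "continuous_map ?P ?P ?T"
      using continuous_map_compose[OF continuous_map_fst cLO.\<psi>_continuous[OF g]]
        continuous_map_compose[OF continuous_map_snd \<psi>_continuous[OF g]]
      by (intro continuous_map_pairedI) (simp_all add: o_def)
    then have "?T ` ?\<Gamma> \<subseteq> ?P closure_of (?T ` ?O)"
      unfolding graph_closure_def by (rule continuous_map_image_closure_subset)
    also have "?T ` ?O \<subseteq> ?O"
    proof clarify
      fix k assume k: "k \<in> carrier G"
      then show "\<exists>l. ?T (act k lexo, \<psi> k y) = (act l lexo, \<psi> l y) \<and> l \<in> carrier G"
        using g act_mult[OF lex_in_cLO g k] \<psi>_mult[OF g k y] by (intro exI[of _ "g \<otimes>\<^bsub>G\<^esub> k"]) simp
    qed
    then have "?P closure_of (?T ` ?O) \<subseteq> ?\<Gamma>" unfolding graph_closure_def by (rule closure_of_mono)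
    finally have "?T (r, \<pi> r) \<in> ?\<Gamma>" using \<pi>\<Gamma>[OF r] by blast
    then show "(act g r, \<psi> g (\<pi> r)) \<in> ?\<Gamma>" by simp
  qed auto
  then have "flow_hom G (cLO_topology S) act Y \<psi> \<pi>" using \<pi>c by (simp add: flow_hom_def)
  then show ?thesis by blast
qed

end

text \<open>
  The image is closed and contains an orbit.
\<close>

lemma flow_hom_onto_minimal:
  assumes X: "flow G T X \<phi>" and Y: "minimal_flow G T Y \<psi>" and \<pi>: "flow_hom G X \<phi> Y \<psi> \<pi>"
  shows "\<pi> ` topspace X = topspace Y"
proof
  have cont: "continuous_map X Y \<pi>" using \<pi> by (simp add: flow_hom_def)
  show sub: "\<pi> ` topspace X \<subseteq> topspace Y" by (rule continuous_map_image_subset_topspace[OF cont])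
  have fl: "compact_space X" "topspace X \<noteq> {}" "group_action G (topspace X) \<phi>" "Hausdorff_space Y"
    using X Y by (simp_all add: flow_def minimal_flow_def)
  obtain x where x: "x \<in> topspace X" using fl(2) by blast
  have "closedin Y (\<pi> ` topspace X)"
    using image_compactin[OF fl(1)[unfolded compact_space_def] cont] by (rule compactin_imp_closedin[OF fl(4)])
  moreover have "orbit G \<psi> (\<pi> x) \<subseteq> \<pi> ` topspace X"
  proof
    fix z assume "z \<in> orbit G \<psi> (\<pi> x)"
    then obtain g where g: "g \<in> carrier G" "z = \<psi> g (\<pi> x)" by (auto simp: orbit_def)
    then have "z = \<pi> (\<phi> g x)" using \<pi> x by (simp add: flow_hom_def)
    then show "z \<in> \<pi> ` topspace X" using group_action.element_image[OF fl(3) g(1) x] by blast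
  qed
  ultimately have "Y closure_of orbit G \<psi> (\<pi> x) \<subseteq> \<pi> ` topspace X" by (intro closure_of_minimal)
  moreover have "\<pi> x \<in> topspace Y" using sub x by blast
  ultimately show "topspace Y \<subseteq> \<pi> ` topspace X" using Y by (simp add: minimal_flow_def)
qed

lemma (in distance_set) universal_cLO:
  "universal_minimal_flow TYPE('y) G (iso_topology S) (cLO_topology S) act"
  unfolding universal_minimal_flow_def
proof (intro conjI allI impI)
  show "minimal_flow G (iso_topology S) (cLO_topology S) act" by (rule minimal_cLO)
  fix Y :: "'y topology" and \<psi> assume Y: "minimal_flow G (iso_topology S) Y \<psi>"
  interpret Y: iso_flow S Y \<psi> by unfold_locales (use Y in \<open>simp add: minimal_flow_def\<close>)
  obtain \<pi> where "flow_hom G (cLO_topology S) act Y \<psi> \<pi>" using Y.flow_hom_from_cLO by blast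
  then show "\<exists>\<pi>. flow_hom G (cLO_topology S) act Y \<psi> \<pi> \<and> \<pi> ` topspace (cLO_topology S) = topspace Y"
    using flow_hom_onto_minimal[OF flow_cLO Y] by blast
qed

theorem theorem37:
  fixes S :: "real set"
  assumes "countable S" and "S \<subseteq> {0<..}"
  shows "universal_minimal_flow TYPE('y)
           (iso_group S) (iso_topology S) (cLO_topology S) (cLO_action S) \<and>
         (\<forall>(Z :: 'z topology) \<psi>.
            universal_minimal_flow TYPE(point rel) (iso_group S) (iso_topology S) Z \<psi> \<longrightarrow>
            flow_isomorphic (iso_group S) (cLO_topology S) (cLO_action S) Z \<psi>)"
proof -
  interpret distance_set S by unfold_locales (rule assms(2))
  have iso: "flow_isomorphic G (cLO_topology S) act Z \<psi>"
    if Z: "universal_minimal_flow TYPE(point rel) G (iso_topology S) Z \<psi>" for Z :: "'z topology" and \<psi>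
  proof -
    have minZ: "minimal_flow G (iso_topology S) Z \<psi>"
      and "\<exists>\<rho>. flow_hom G Z \<psi> (cLO_topology S) act \<rho>"
      using Z minimal_cLO unfolding universal_minimal_flow_def by blast+
    then obtain \<rho> where \<rho>: "flow_hom G Z \<psi> (cLO_topology S) act \<rho>" by blast
    obtain \<sigma> where \<sigma>: "flow_hom G (cLO_topology S) act Z \<psi> \<sigma>"
      and onto: "\<sigma> ` topspace (cLO_topology S) = topspace Z"
      using universal_cLO minZ unfolding universal_minimal_flow_def by blast
    have \<sigma>c: "continuous_map (cLO_topology S) Z \<sigma>" using \<sigma> by (simp add: flow_hom_def)
    have "flow_hom G (cLO_topology S) act (cLO_topology S) act (\<rho> \<circ> \<sigma>)"
      unfolding flow_hom_def
    proof (intro conjI ballI)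
      show "continuous_map (cLO_topology S) (cLO_topology S) (\<rho> \<circ> \<sigma>)"
        using \<rho> \<sigma>c by (auto simp: flow_hom_def intro: continuous_map_compose)
      fix g r assume "g \<in> carrier G" "r \<in> topspace (cLO_topology S)"
      then show "(\<rho> \<circ> \<sigma>) (act g r) = act g ((\<rho> \<circ> \<sigma>) r)"
        using \<rho> \<sigma> continuous_map_image_subset_topspace[OF \<sigma>c] by (auto simp: flow_hom_def)
    qed
    then obtain E where E: "\<And>r. r \<in> cLO S \<Longrightarrow> \<rho> (\<sigma> r) = fl E r"
      using cLO_endomorphism_is_flip by fastforce
    have inj: "inj_on \<sigma> (topspace (cLO_topology S))"
    proof (rule inj_onI)
      fix r q assume "r \<in> topspace (cLO_topology S)" "q \<in> topspace (cLO_topology S)" "\<sigma> r = \<sigma> q"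
      then have "fl E (fl E r) = fl E (fl E q)" "r \<in> cLO S" "q \<in> cLO S" using E[of r] E[of q] by auto
      then show "r = q" by (simp add: flip_flip)
    qed
    have "Hausdorff_space Z" using minZ by (simp add: minimal_flow_def flow_def)
    then have "homeomorphic_map (cLO_topology S) Z \<sigma>"
      using T1_Spaces.continuous_imp_closed_map[OF \<sigma>c compact_cLO] \<sigma>c onto inj
      by (intro bijective_closed_imp_homeomorphic_map)
    then show ?thesis using \<sigma> unfolding flow_isomorphic_def by blast
  qed
  then show ?thesis using universal_cLO by blast
qed

end
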